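(* Let $X\subset\mathbb{P}^4$ be a smooth cubic threefold over $\mathbb{C}$ defined by an irreducible homogeneous polynomial $F=F(x_1,\dots,x_5)$ of degree $3$, and let $G\subset\mathrm{Aut}(X)\subset\mathrm{PGL}(5,\mathbb{C})$ be a subgroup. Then $G$ admits an $F$-lifting.
   Context: The automorphism group $\mathrm{Aut}(X)$ is finite and is identified with $\{f\in\mathrm{Aut}(\mathbb{P}^4)=\mathrm{PGL}(5,\mathbb{C}) : f(X)=X\}$, where $[A]\in\mathrm{PGL}(5,\mathbb{C})$ acts on $\mathbb{P}^4$ by matrix multiplication $z\mapsto Az$ on column vectors of homogeneous coordinates. For $A=(a_{ij})\in\mathrm{GL}(5,\mathbb{C})$, $A(F)$ denotes the polynomial $F(\sum_i a_{1i}x_i,\dots,\sum_i a_{5i}x_i)$. Let $\pi:\mathrm{GL}(5,\mathbb{C})\to\mathrm{PGL}(5,\mathbb{C})$ be the quotient map. For a finite subgroup $G<\mathrm{PGL}(5,\mathbb{C})$, a lifting of $G$ is a subgroup $\widetilde G<\mathrm{GL}(5,\mathbb{C})$ such that $\pi$ restricts to an isomorphism $\widetilde G\to G$; it is an $F$-lifting if moreover $A(F)=F$ for all $A\in\widetilde G$. *)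

theory Defs
  imports
    "HOL-Analysis.Determinants"
    "HOL-Library.Poly_Mapping"
    "HOL-Library.Numeral_Type"
    "HOL-Computational_Algebra.Factorial_Ring"
    "HOL-Algebra.Coset"
begin

section \<open>Polynomials in variables indexed by a finite type\<close>

text \<open>
  A polynomial is a finitely supported map from exponent vectors to coefficients, so that the
  ring structure on \<open>poly_mapping\<close> (convolution product) is the polynomial ring, and
  \<^const>\<open>irreducible\<close> at this type is irreducibility in that ring.
\<close>

type_synonym ('n, 'a) mpolynomial = "('n \<Rightarrow>\<^sub>0 nat) \<Rightarrow>\<^sub>0 'a"

definition mconst :: "'a \<Rightarrow> ('n, 'a::comm_semiring_1) mpolynomial" where
  "mconst c = Poly_Mapping.single 0 c"

definition mvar :: "'n \<Rightarrow> ('n, 'a::comm_semiring_1) mpolynomial" where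
  "mvar i = Poly_Mapping.single (Poly_Mapping.single i 1) 1"

definition meval :: "('n::finite, 'a::comm_semiring_1) mpolynomial \<Rightarrow> 'a ^ 'n \<Rightarrow> 'a" where
  "meval F z = (\<Sum>m\<in>Poly_Mapping.keys F.
     Poly_Mapping.lookup F m * (\<Prod>i\<in>UNIV. (z $ i) ^ Poly_Mapping.lookup m i))"

definition mhomogeneous :: "nat \<Rightarrow> ('n::finite, 'a::comm_semiring_1) mpolynomial \<Rightarrow> bool" where
  "mhomogeneous d F \<longleftrightarrow>
     (\<forall>m\<in>Poly_Mapping.keys F. (\<Sum>i\<in>UNIV. Poly_Mapping.lookup m i) = d)"

text \<open>
  The formal partial derivative. Exponent vectors not involving the variable \<open>i\<close> contribute
  nothing because of the factor \<open>of_nat 0\<close>; the subtraction of exponents is then irrelevant.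
\<close>

definition mpderiv ::
    "'n \<Rightarrow> ('n::finite, 'a::comm_semiring_1) mpolynomial \<Rightarrow> ('n, 'a) mpolynomial" where
  "mpderiv i F = (\<Sum>m\<in>Poly_Mapping.keys F.
     Poly_Mapping.single (m - Poly_Mapping.single i 1)
       (of_nat (Poly_Mapping.lookup m i) * Poly_Mapping.lookup F m))"

definition msubst ::
    "('n \<Rightarrow> ('n, 'a) mpolynomial) \<Rightarrow> ('n::finite, 'a::comm_semiring_1) mpolynomial
       \<Rightarrow> ('n, 'a) mpolynomial" where
  "msubst \<sigma> F = (\<Sum>m\<in>Poly_Mapping.keys F.
     mconst (Poly_Mapping.lookup F m) * (\<Prod>i\<in>UNIV. \<sigma> i ^ Poly_Mapping.lookup m i))"

text \<open>\<open>A(F) = F(\<Sum>\<^sub>j a\<^sub>1\<^sub>j x\<^sub>j, \<dots>, \<Sum>\<^sub>j a\<^sub>n\<^sub>j x\<^sub>j)\<close>: the \<open>i\<close>-th variable is replaced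
  by the linear form given by the \<open>i\<close>-th row.\<close>

definition mat_subst ::
    "'a ^ 'n ^ 'n \<Rightarrow> ('n::finite, 'a::comm_semiring_1) mpolynomial \<Rightarrow> ('n, 'a) mpolynomial" where
  "mat_subst A F = msubst (\<lambda>i. \<Sum>j\<in>UNIV. mconst (A $ i $ j) * mvar j) F"


section \<open>The groups GL and PGL\<close>

definition GL :: "('a::field ^ 'n ^ 'n) monoid" where
  "GL = \<lparr>carrier = {A. invertible A}, mult = (**), one = mat 1\<rparr>"

definition scalar_mats :: "('a::field ^ 'n ^ 'n) set" where
  "scalar_mats = {mat c | c. c \<noteq> 0}"

definition PGL :: "('a::field ^ 'n ^ 'n) set monoid" where
  "PGL = GL Mod scalar_mats"

definition GL_to_PGL :: "'a::field ^ 'n ^ 'n \<Rightarrow> ('a ^ 'n ^ 'n) set" where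
  "GL_to_PGL A = scalar_mats #>\<^bsub>GL\<^esub> A"

lemma group_GL: "group (GL :: ('a::field ^ 'n ^ 'n) monoid)"
proof (rule groupI)
  fix A :: "'a ^ 'n ^ 'n"
  assume "A \<in> carrier GL"
  then obtain B where "A ** B = mat 1" "B ** A = mat 1"
    by (auto simp: GL_def invertible_def)
  then show "\<exists>B\<in>carrier GL. B \<otimes>\<^bsub>GL\<^esub> A = \<one>\<^bsub>GL\<^esub>"
    by (auto simp: GL_def invertible_def)
next
  have "invertible (mat 1 :: 'a ^ 'n ^ 'n)"
    unfolding invertible_def by (rule exI[of _ "mat 1"]) simp
  then show "\<one>\<^bsub>GL\<^esub> \<in> carrier (GL :: ('a ^ 'n ^ 'n) monoid)"
    by (simp add: GL_def)
qed (simp_all add: GL_def invertible_mult matrix_mul_assoc)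

lemma mat_mult_nth:
  fixes A :: "'a::field ^ 'n ^ 'n"
  shows "(mat c ** A) $ i $ j = c * A $ i $ j"
    and "(A ** mat c) $ i $ j = A $ i $ j * c"
proof -
  have "(mat c ** A) $ i $ j = (\<Sum>k\<in>UNIV. if k = i then c * A $ k $ j else 0)"
    by (simp only: matrix_matrix_mult_def mat_def vec_lambda_beta) (rule sum.cong, auto)
  then show "(mat c ** A) $ i $ j = c * A $ i $ j"
    by simp
  have "(A ** mat c) $ i $ j = (\<Sum>k\<in>UNIV. if k = j then A $ i $ k * c else 0)"
    by (simp only: matrix_matrix_mult_def mat_def vec_lambda_beta) (rule sum.cong, auto)
  then show "(A ** mat c) $ i $ j = A $ i $ j * c"
    by simp
qed

lemma mat_mult_commute: "mat c ** A = (A :: 'a::field ^ 'n ^ 'n) ** mat c"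
  by (simp add: vec_eq_iff mat_mult_nth mult.commute)

lemma mat_mult_mat: "mat c ** mat d = (mat (c * d) :: 'a::field ^ 'n ^ 'n)"
  by (simp add: vec_eq_iff mat_mult_nth) (simp add: mat_def)

lemma scalar_mats_inverse:
  assumes "(c::'a::field) \<noteq> 0"
  shows "mat (inverse c) ** mat c = (mat 1 :: 'a ^ 'n ^ 'n)"
    and "mat c ** mat (inverse c) = (mat 1 :: 'a ^ 'n ^ 'n)"
  using assms by (simp_all add: mat_mult_mat)

lemma invertible_scalar_mat:
  assumes "(c::'a::field) \<noteq> 0"
  shows "invertible (mat c :: 'a ^ 'n ^ 'n)"
  unfolding invertible_def using scalar_mats_inverse[OF assms] by blast

lemma normal_scalar_mats: "scalar_mats \<lhd> (GL :: ('a::field ^ 'n ^ 'n) monoid)"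
proof -
  interpret group "GL :: ('a ^ 'n ^ 'n) monoid" by (rule group_GL)
  have "subgroup scalar_mats (GL :: ('a ^ 'n ^ 'n) monoid)"
  proof (rule subgroupI)
    show "scalar_mats \<subseteq> carrier (GL :: ('a ^ 'n ^ 'n) monoid)"
      by (auto simp: scalar_mats_def GL_def invertible_scalar_mat)
    show "(scalar_mats :: ('a ^ 'n ^ 'n) set) \<noteq> {}"
      by (auto simp: scalar_mats_def intro: exI[of _ 1])
    fix A :: "'a ^ 'n ^ 'n"
    assume "A \<in> scalar_mats"
    then obtain c where c: "A = mat c" "c \<noteq> 0"
      by (auto simp: scalar_mats_def)
    have "inv\<^bsub>GL\<^esub> A = mat (inverse c)"
      by (rule inv_equality)
        (use c in \<open>auto simp: GL_def invertible_scalar_mat scalar_mats_inverse\<close>)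
    then show "inv\<^bsub>GL\<^esub> A \<in> scalar_mats"
      using c by (auto simp: scalar_mats_def intro!: exI[of _ "inverse c"])
  next
    fix A B :: "'a ^ 'n ^ 'n"
    assume "A \<in> scalar_mats" "B \<in> scalar_mats"
    then obtain c d where "A = mat c" "c \<noteq> 0" "B = mat d" "d \<noteq> 0"
      by (auto simp: scalar_mats_def)
    then show "A \<otimes>\<^bsub>GL\<^esub> B \<in> scalar_mats"
      by (auto simp: scalar_mats_def GL_def mat_mult_mat intro!: exI[of _ "c * d"])
  qed
  then show ?thesis
    by (rule normalI) (auto simp: r_coset_def l_coset_def GL_def scalar_mats_def mat_mult_commute)
qed

lemma group_PGL: "group (PGL :: ('a::field ^ 'n ^ 'n) set monoid)"
  unfolding PGL_def by (rule normal.factorgroup_is_group[OF normal_scalar_mats])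


section \<open>Projective hypersurfaces and their linear automorphisms\<close>

text \<open>
  The point of projective space with homogeneous coordinates \<open>z \<noteq> 0\<close> is the class of all nonzero
  multiples of \<open>z\<close>.
\<close>

definition proj_point :: "'a::field ^ 'n \<Rightarrow> ('a ^ 'n) set" where
  "proj_point z = {c *s z | c. c \<noteq> 0}"

definition proj_hypersurface :: "('n::finite, 'a::field) mpolynomial \<Rightarrow> ('a ^ 'n) set set" where
  "proj_hypersurface F = {proj_point z | z. z \<noteq> 0 \<and> meval F z = 0}"

text \<open>The Jacobian criterion at every point; meant for \<open>F\<close> square-free, over an algebraically
  closed field.\<close>

definition smooth_hypersurface :: "('n::finite, 'a::field) mpolynomial \<Rightarrow> bool" where
  "smooth_hypersurface F \<longleftrightarrow>
     (\<forall>z. z \<noteq> 0 \<and> meval F z = 0 \<longrightarrow> (\<exists>i. meval (mpderiv i F) z \<noteq> 0))"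

text \<open>
  An element \<open>g\<close> of PGL is a coset of matrices and a point \<open>p\<close> is a class of vectors; the products
  \<open>A *v z\<close> with \<open>A \<in> g\<close> and \<open>z \<in> p\<close> form a single class again, namely \<open>[A z]\<close>
  (see \<open>PGL_act_proj_point\<close>).
\<close>

definition PGL_act :: "('a::field ^ 'n ^ 'n) set \<Rightarrow> ('a ^ 'n) set \<Rightarrow> ('a ^ 'n) set" where
  "PGL_act g p = {A *v z | A z. A \<in> g \<and> z \<in> p}"

lemma mat_mult_vec:
  fixes z :: "'a::field ^ 'n"
  shows "mat c *v z = c *s z"
proof -
  have "(mat c *v z) $ i = (\<Sum>k\<in>UNIV. if k = i then c * z $ k else 0)" for i
    by (simp only: matrix_vector_mult_def mat_def vec_lambda_beta) (rule sum.cong, auto)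
  then show ?thesis
    by (simp add: vec_eq_iff)
qed

lemma PGL_act_proj_point: "PGL_act (GL_to_PGL A) (proj_point z) = proj_point (A *v z)"
proof (rule subset_antisym; rule subsetI)
  fix w assume "w \<in> PGL_act (GL_to_PGL A) (proj_point z)"
  then obtain c d where cd: "c \<noteq> 0" "d \<noteq> 0" "w = (mat c ** A) *v (d *s z)"
    by (auto simp: PGL_act_def GL_to_PGL_def r_coset_def GL_def scalar_mats_def proj_point_def)
  then have "w = (c * d) *s (A *v z)"
    by (simp add: matrix_vector_mul_assoc[symmetric] mat_mult_vec vector_scalar_commute
        vector_smult_assoc)
  then show "w \<in> proj_point (A *v z)"
    using cd by (auto simp: proj_point_def intro!: exI[of _ "c * d"])
next
  fix w assume "w \<in> proj_point (A *v z)"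
  then obtain c where c: "c \<noteq> 0" "w = c *s (A *v z)"
    by (auto simp: proj_point_def)
  then have "w = (mat c ** A) *v z"
    by (simp add: matrix_vector_mul_assoc[symmetric] mat_mult_vec)
  moreover have "mat c ** A \<in> GL_to_PGL A"
    using c by (auto simp: GL_to_PGL_def r_coset_def GL_def scalar_mats_def)
  moreover have "z \<in> proj_point z"
    by (auto simp: proj_point_def intro!: exI[of _ 1])
  ultimately show "w \<in> PGL_act (GL_to_PGL A) (proj_point z)"
    by (auto simp: PGL_act_def)
qed

definition lin_Aut :: "('a::field ^ 'n) set set \<Rightarrow> ('a ^ 'n ^ 'n) set set" where
  "lin_Aut X = {g \<in> carrier PGL. PGL_act g ` X = X}"


section \<open>Liftings\<close>

text \<open>Liftings are usually considered for finite groups only; finiteness plays no role in the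
  definition.\<close>

definition is_lifting :: "('a::field ^ 'n ^ 'n) set set \<Rightarrow> ('a ^ 'n ^ 'n) set \<Rightarrow> bool" where
  "is_lifting G H \<longleftrightarrow>
     subgroup H GL \<and> GL_to_PGL \<in> iso (GL\<lparr>carrier := H\<rparr>) (PGL\<lparr>carrier := G\<rparr>)"

definition is_F_lifting ::
    "('n::finite, 'a::field) mpolynomial \<Rightarrow> ('a ^ 'n ^ 'n) set set \<Rightarrow> ('a ^ 'n ^ 'n) set \<Rightarrow> bool" where
  "is_F_lifting F G H \<longleftrightarrow> is_lifting G H \<and> (\<forall>A\<in>H. mat_subst A F = F)"

end

(*
  Polarization turns F into a symmetric trilinear form T, smooth in the sense that
  T(z, z, -) is nonzero for every z other than 0.

  If A preserves the zero set of F, then A(F) = c F: a generic line through a point of the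
  hypersurface meets it in three distinct points, so F and A(F) are proportional on that line.
  After rescaling A by a cube root, A(F) = F, and A is then determined up to a cube root of unity.

  It remains to split off these cube roots of unity, for which a power of the determinant serves.
  Let A(F) = F, and decompose the space into generalized eigenspaces of A. T can be nonzero only on
  triples of eigenvalues with product 1, so by smoothness w -> w^(-2) maps the set of eigenvalues
  to itself; in dimension 5 all eigenvalues are therefore roots of unity of order dividing
  7920 = 9 * 880. Put B = A^880, whose eigenvalues are ninth roots of unity. The eigenvalues w of B
  with w^3 other than 1 come in orbits {w, w^(-2), w^4}. Smoothness forbids an eigenvalue of
  multiplicity at least 2 whose successor w^(-2) is simple, so in dimension 5 there is at most
  one orbit and it consists of simple eigenvalues. Hence det(B)^3 = 1, that is, det^880 is a
  character with values in the cube roots of unity. It is nontrivial on the scalar cube roots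
  of unity, since 5 * 880 is not divisible by 3, so its kernel is the lifting.
*)
theory Submission
  imports
    Defs
    "HOL-Computational_Algebra.Fundamental_Theorem_Algebra"
    "Jordan_Normal_Form.Jordan_Normal_Form_Existence"
begin

hide_const (open) Matrix.mat Matrix.vec Matrix.row Matrix.col Matrix.transpose_mat Determinant.det
hide_fact (open) Matrix.vec_eq_iff Matrix.mat_def Matrix.row_def Determinant.det_def
no_notation Matrix.vec_index (infixl "$" 100)

section \<open>Evaluation of polynomials\<close>

lemma meval_superset:
  assumes "finite K" "Poly_Mapping.keys F \<subseteq> K"
  shows "meval F z = (\<Sum>m\<in>K. Poly_Mapping.lookup F m * (\<Prod>i\<in>UNIV. (z $ i) ^ Poly_Mapping.lookup m i))"
  unfolding meval_def
  by (rule sum.mono_neutral_left) (use assms in \<open>auto simp: in_keys_iff\<close>)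

lemma meval_zero [simp]: "meval 0 z = 0"
  by (simp add: meval_def)

lemma meval_add: "meval (F + G) z = meval F z + meval G z"
proof -
  let ?K = "Poly_Mapping.keys F \<union> Poly_Mapping.keys G"
  have "Poly_Mapping.keys (F + G) \<subseteq> ?K"
    by (rule keys_add)
  then show ?thesis
    by (simp add: meval_superset[of ?K] lookup_add distrib_right sum.distrib)
qed

lemma meval_sum: "meval (\<Sum>i\<in>S. f i) z = (\<Sum>i\<in>S. meval (f i) z)"
  by (induction S rule: infinite_finite_induct) (simp_all add: meval_add)

lemma meval_single:
  "meval (Poly_Mapping.single m c) z = c * (\<Prod>i\<in>UNIV. (z $ i) ^ Poly_Mapping.lookup m i)"
  by (subst meval_superset[of "{m}"]) auto

lemma poly_mapping_sum_single:
  "F = (\<Sum>m\<in>Poly_Mapping.keys F. Poly_Mapping.single m (Poly_Mapping.lookup F m))"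
  by (rule poly_mapping_eqI)
    (auto simp: lookup_sum lookup_single when_def in_keys_iff)

lemma meval_mult: "meval (F * G) z = meval F z * meval G z"
proof -
  have "F * G = (\<Sum>m\<in>Poly_Mapping.keys F. \<Sum>m'\<in>Poly_Mapping.keys G.
      Poly_Mapping.single (m + m') (Poly_Mapping.lookup F m * Poly_Mapping.lookup G m'))"
    by (subst poly_mapping_sum_single[of F], subst poly_mapping_sum_single[of G])
      (simp add: sum_product mult_single)
  then have "meval (F * G) z = (\<Sum>m\<in>Poly_Mapping.keys F. \<Sum>m'\<in>Poly_Mapping.keys G.
      (Poly_Mapping.lookup F m * (\<Prod>i\<in>UNIV. (z $ i) ^ Poly_Mapping.lookup m i)) *
      (Poly_Mapping.lookup G m' * (\<Prod>i\<in>UNIV. (z $ i) ^ Poly_Mapping.lookup m' i)))"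
    by (simp add: meval_sum meval_single lookup_add power_add prod.distrib mult_ac)
  then show ?thesis
    by (simp add: meval_def sum_product)
qed

lemma meval_mconst [simp]: "meval (mconst c) z = c"
  by (simp add: mconst_def meval_single)

lemma meval_one [simp]: "meval 1 z = 1"
  using meval_mconst[of 1 z] by (simp add: mconst_def)

lemma meval_power: "meval (F ^ k) z = meval F z ^ k"
  by (induction k) (simp_all add: meval_mult)

lemma meval_prod: "meval (\<Prod>i\<in>S. f i) z = (\<Prod>i\<in>S. meval (f i) z)"
  by (induction S rule: infinite_finite_induct) (simp_all add: meval_mult)

lemma meval_mvar [simp]: "meval (mvar i) z = z $ i"
proof -
  have "(\<Prod>j\<in>UNIV. (z $ j) ^ Poly_Mapping.lookup (Poly_Mapping.single i 1) j)
      = (\<Prod>j\<in>UNIV. if j = i then z $ j else 1)"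
    by (rule prod.cong) (auto simp: lookup_single when_def)
  then show ?thesis
    by (simp add: mvar_def meval_single)
qed

lemma meval_msubst: "meval (msubst \<sigma> F) z = meval F (\<chi> i. meval (\<sigma> i) z)"
  by (simp add: msubst_def meval_sum meval_mult meval_prod meval_power)
    (simp add: meval_def)

lemma meval_mat_subst: "meval (mat_subst A F) z = meval F (A *v z)"
  by (simp add: mat_subst_def meval_msubst meval_sum meval_mult matrix_vector_mult_def)

text \<open>Kronecker substitution: a base exceeding all exponents makes the monomials distinct
  powers of one variable.\<close>

lemma digits_unique:
  fixes a b :: "nat \<Rightarrow> nat"
  assumes "(\<Sum>i<n. a i * N ^ i) = (\<Sum>i<n. b i * N ^ i)"
    and "\<And>i. i < n \<Longrightarrow> a i < N" "\<And>i. i < n \<Longrightarrow> b i < N" and "i < n"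
  shows "a i = b i"
  using assms
proof (induction n arbitrary: a b i)
  case (Suc n)
  have split: "(\<Sum>i<Suc n. c i * N ^ i) = c 0 + N * (\<Sum>i<n. c (Suc i) * N ^ i)"
    for c :: "nat \<Rightarrow> nat"
    by (simp only: sum.lessThan_Suc_shift sum_distrib_left) (simp add: mult_ac)
  have N: "N > 0"
    using Suc.prems(2)[of 0] by simp
  have eq: "a 0 + N * (\<Sum>i<n. a (Suc i) * N ^ i) = b 0 + N * (\<Sum>i<n. b (Suc i) * N ^ i)"
    using Suc.prems(1) unfolding split .
  have "a 0 = b 0"
    using arg_cong[OF eq, of "\<lambda>x. x mod N"] Suc.prems(2,3)[of 0] by simp
  moreover have "(\<Sum>i<n. a (Suc i) * N ^ i) = (\<Sum>i<n. b (Suc i) * N ^ i)"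
    using arg_cong[OF eq, of "\<lambda>x. x div N"] Suc.prems(2,3)[of 0] N by simp
  then have "i < n \<Longrightarrow> a (Suc i) = b (Suc i)" for i
    using Suc.IH[of "\<lambda>i. a (Suc i)" "\<lambda>i. b (Suc i)" i] Suc.prems(2,3) by simp
  ultimately show ?case
    using Suc.prems(4) by (cases i) auto
qed simp

lemma exists_separating_weights:
  fixes K :: "('n::finite \<Rightarrow>\<^sub>0 nat) set"
  assumes "finite K"
  obtains w :: "'n \<Rightarrow> nat" where "inj_on (\<lambda>m. \<Sum>i\<in>UNIV. Poly_Mapping.lookup m i * w i) K"
proof -
  obtain g :: "nat \<Rightarrow> 'n" where g: "bij_betw g {..<CARD('n)} UNIV"
    by (metis bij_betw_from_nat_into_finite finite_class.finite_UNIV)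
  \<comment> \<open>A crude base: one more than the sum of all exponents of all monomials in
    \<open>K\<close>, so every exponent is a legal digit.\<close>
  define N where "N = Suc (\<Sum>m\<in>K. \<Sum>i\<in>UNIV. Poly_Mapping.lookup m i)"
  have less: "Poly_Mapping.lookup m i < N" if "m \<in> K" for m i
  proof -
    have "Poly_Mapping.lookup m i \<le> (\<Sum>i\<in>UNIV. Poly_Mapping.lookup m i)"
      by (rule member_le_sum) auto
    also have "\<dots> \<le> (\<Sum>m\<in>K. \<Sum>i\<in>UNIV. Poly_Mapping.lookup m i)"
      using that assms by (intro member_le_sum) auto
    finally show ?thesis
      by (simp add: N_def)
  qed
  define w where "w i = N ^ (inv_into {..<CARD('n)} g i)" for i
  have w: "w (g j) = N ^ j" if "j < CARD('n)" for j
    using that g by (simp add: w_def bij_betw_inv_into_left)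
  have sum_eq: "(\<Sum>i\<in>UNIV. Poly_Mapping.lookup m i * w i)
      = (\<Sum>j<CARD('n). Poly_Mapping.lookup m (g j) * N ^ j)" for m
    by (subst sum.reindex_bij_betw[OF g, symmetric]) (simp add: w)
  have "inj_on (\<lambda>m. \<Sum>i\<in>UNIV. Poly_Mapping.lookup m i * w i) K"
  proof (rule inj_onI)
    fix m m' assume m: "m \<in> K" "m' \<in> K"
      and eq: "(\<Sum>i\<in>UNIV. Poly_Mapping.lookup m i * w i) = (\<Sum>i\<in>UNIV. Poly_Mapping.lookup m' i * w i)"
    have "Poly_Mapping.lookup m (g j) = Poly_Mapping.lookup m' (g j)" if "j < CARD('n)" for j
      using digits_unique[OF eq[unfolded sum_eq]] less m that by blast
    moreover have "\<exists>j<CARD('n). i = g j" for i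
      using g by (auto simp: bij_betw_def image_iff set_eq_iff)
    ultimately show "m = m'"
      by (intro poly_mapping_eqI) metis
  qed
  then show ?thesis
    using that by blast
qed

text \<open>Substituting \<open>s ^ w i\<close> for the variable \<open>i\<close> gives a univariate
  polynomial \<open>p\<close> in which distinct monomials of \<open>F\<close> land in distinct
  degrees. As \<open>p\<close> vanishes on an infinite field, all its coefficients are 0, and these
  are the coefficients of \<open>F\<close>.\<close>

lemma meval_eq_zeroD:
  fixes F :: "('n::finite, 'a::{field, ring_char_0}) mpolynomial"
  assumes "\<And>z. meval F z = 0"
  shows "F = 0"
proof (rule poly_mapping_eqI)
  fix m0
  obtain w where w: "inj_on (\<lambda>m. \<Sum>i\<in>UNIV. Poly_Mapping.lookup m i * w i) (Poly_Mapping.keys F)"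
    using exists_separating_weights[of "Poly_Mapping.keys F"] by auto
  define e where "e m = (\<Sum>i\<in>UNIV. Poly_Mapping.lookup m i * w i)" for m
  define p where "p = (\<Sum>m\<in>Poly_Mapping.keys F. monom (Poly_Mapping.lookup F m) (e m))"
  have "poly p s = meval F (\<chi> i. s ^ w i)" for s
    by (simp add: p_def poly_sum poly_monom meval_def e_def power_sum power_mult[symmetric] mult.commute)
  then have "p = 0"
    using assms poly_all_0_iff_0 by metis
  show "Poly_Mapping.lookup F m0 = Poly_Mapping.lookup 0 m0"
  proof (cases "m0 \<in> Poly_Mapping.keys F")
    case True
    have "coeff p (e m0) = (\<Sum>m\<in>Poly_Mapping.keys F. if m = m0 then Poly_Mapping.lookup F m else 0)"
      unfolding p_def coeff_sum
      by (rule sum.cong) (use True w in \<open>auto simp: e_def dest: inj_onD\<close>)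
    then show ?thesis
      using True \<open>p = 0\<close> by simp
  qed (simp add: in_keys_iff)
qed

lemma meval_inject:
  fixes F G :: "('n::finite, 'a::{field, ring_char_0}) mpolynomial"
  assumes "\<And>z. meval F z = meval G z"
  shows "F = G"
proof -
  have "meval (F - G) z = 0" for z
    using meval_add[of "F - G" G z] assms by simp
  then show ?thesis
    using meval_eq_zeroD[of "F - G"] by simp
qed

section \<open>Cubic forms and symmetric trilinear forms\<close>

text \<open>Models the polarization of a cubic form, the form itself being \<open>T z z z\<close>.
  Linearity in the second and third argument comes from symmetry.\<close>

locale sym_trilinear =
  fixes T :: "'a::field ^ 'n \<Rightarrow> 'a ^ 'n \<Rightarrow> 'a ^ 'n \<Rightarrow> 'a"
  assumes swap12: "T x y z = T y x z"
    and swap23: "T x y z = T x z y"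
    and add1: "T (x + x') y z = T x y z + T x' y z"
    and scale1: "T (c *s x) y z = c * T x y z"
begin

lemma add2: "T x (y + y') z = T x y z + T x y' z"
  by (metis swap12 add1)

lemma add3: "T x y (z + z') = T x y z + T x y z'"
  by (metis swap23 add2)

lemma scale2: "T x (c *s y) z = c * T x y z"
  by (metis swap12 scale1)

lemma scale3: "T x y (c *s z) = c * T x y z"
  by (metis swap23 scale2)

lemmas linear_simps = add1 add2 add3 scale1 scale2 scale3

lemma zero [simp]: "T 0 y z = 0" "T x 0 z = 0" "T x y 0 = 0"
  using scale1[of 0 0 y z] scale2[of x 0 0 z] scale3[of x y 0 0] by simp_all

lemma sum3: "T x y (\<Sum>i\<in>S. f i) = (\<Sum>i\<in>S. T x y (f i))"
  by (induction S rule: infinite_finite_induct) (simp_all add: add3)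

lemma expand3: "T x y z = (\<Sum>i\<in>UNIV. z $ i * T x y (axis i 1))"
proof -
  have "T x y z = T x y (\<Sum>i\<in>UNIV. z $ i *s axis i 1)"
    by (simp add: basis_expansion)
  then show ?thesis
    by (simp only: sum3 scale3)
qed

lemma cube_line:
  "T (u + t *s v) (u + t *s v) (u + t *s v)
    = T u u u + 3 * t * T u u v + 3 * t ^ 2 * T u v v + t ^ 3 * T v v v"
proof -
  have "T u v u = T u u v" "T v u u = T u u v" "T v u v = T u v v" "T v v u = T u v v"
    by (metis swap12 swap23)+
  then show ?thesis
    by (simp add: linear_simps power2_eq_square power3_eq_cube algebra_simps)
qed

end

section \<open>Existence of the polarization of a cubic form\<close>

lemma sym_trilinear_add:
  assumes "sym_trilinear S" "sym_trilinear T"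
  shows "sym_trilinear (\<lambda>x y z. S x y z + T x y z)"
proof -
  interpret S: sym_trilinear S by fact
  interpret T: sym_trilinear T by fact
  show ?thesis
    by unfold_locales
      (use S.swap12 T.swap12 S.swap23 T.swap23 in
        \<open>auto simp: S.linear_simps T.linear_simps algebra_simps\<close>)
qed

lemma sym_trilinear_scale:
  assumes "sym_trilinear T"
  shows "sym_trilinear (\<lambda>x y z. c * T x y z)"
proof -
  interpret T: sym_trilinear T by fact
  show ?thesis
    by unfold_locales (use T.swap12 T.swap23 in \<open>auto simp: T.linear_simps algebra_simps\<close>)
qed

lemma sym_trilinear_compose:
  assumes "sym_trilinear T"
  shows "sym_trilinear (\<lambda>x y z. T (A *v x) (A *v y) (A *v z))"
proof -
  interpret T: sym_trilinear T by fact
  show ?thesis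
    by unfold_locales
      (use T.swap12 T.swap23 in
        \<open>auto simp: T.linear_simps matrix_vector_right_distrib vector_scalar_commute\<close>)
qed

lemma sym_trilinear_sum:
  assumes "\<And>i. i \<in> I \<Longrightarrow> sym_trilinear (T i)"
  shows "sym_trilinear (\<lambda>x y z. \<Sum>i\<in>I. T i x y z)"
  using assms
proof (induction I rule: infinite_finite_induct)
  case (insert i I)
  then show ?case
    by (simp add: sym_trilinear_add)
qed (simp_all add: sym_trilinear_def)

lemma monomial_split:
  fixes m :: "'n::finite \<Rightarrow>\<^sub>0 nat"
  assumes "(\<Sum>i\<in>UNIV. Poly_Mapping.lookup m i) = Suc k"
  obtains a m' where "m = Poly_Mapping.single a 1 + m'" "(\<Sum>i\<in>UNIV. Poly_Mapping.lookup m' i) = k"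
proof -
  obtain a where a: "Poly_Mapping.lookup m a \<noteq> 0"
    using assms by (metis Suc_neq_Zero sum.neutral)
  have m: "m = Poly_Mapping.single a 1 + (m - Poly_Mapping.single a 1)"
    by (rule poly_mapping_eqI) (use a in \<open>auto simp: lookup_add lookup_minus lookup_single when_def\<close>)
  have "(\<Sum>i\<in>UNIV. Poly_Mapping.lookup m i)
      = (\<Sum>i\<in>UNIV. Poly_Mapping.lookup (Poly_Mapping.single a 1) i)
        + (\<Sum>i\<in>UNIV. Poly_Mapping.lookup (m - Poly_Mapping.single a 1) i)"
    by (subst m) (simp add: lookup_add sum.distrib)
  also have "(\<Sum>i\<in>UNIV. Poly_Mapping.lookup (Poly_Mapping.single a (1::nat)) i) = 1"
    by (simp add: lookup_single when_def)
  finally show ?thesis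
    using that[OF m] assms by simp
qed

lemma monomial_single_mult:
  fixes z :: "'a::comm_semiring_1 ^ 'n"
  shows "(\<Prod>i\<in>UNIV. (z $ i) ^ Poly_Mapping.lookup (Poly_Mapping.single a 1 + m) i)
    = z $ a * (\<Prod>i\<in>UNIV. (z $ i) ^ Poly_Mapping.lookup m i)"
proof -
  have "(\<Prod>i\<in>UNIV. (z $ i) ^ Poly_Mapping.lookup (Poly_Mapping.single a 1) i) = z $ a"
    using meval_mvar[of a z] by (simp add: mvar_def meval_single)
  then show ?thesis
    by (simp add: lookup_add power_add prod.distrib)
qed

lemma cubic_monomial:
  fixes m :: "'n::finite \<Rightarrow>\<^sub>0 nat"
  assumes "(\<Sum>i\<in>UNIV. Poly_Mapping.lookup m i) = 3"
  shows "\<exists>T. sym_trilinear T \<and>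
    (\<forall>z :: 'a::field_char_0 ^ 'n. T z z z = (\<Prod>i\<in>UNIV. (z $ i) ^ Poly_Mapping.lookup m i))"
proof -
  obtain a m1 where m1: "m = Poly_Mapping.single a 1 + m1" "(\<Sum>i\<in>UNIV. Poly_Mapping.lookup m1 i) = 2"
    using monomial_split[of m 2] assms by auto
  obtain b m2 where m2: "m1 = Poly_Mapping.single b 1 + m2" "(\<Sum>i\<in>UNIV. Poly_Mapping.lookup m2 i) = 1"
    using monomial_split[of m1 1] m1 by auto
  obtain c m3 where m3: "m2 = Poly_Mapping.single c 1 + m3" "(\<Sum>i\<in>UNIV. Poly_Mapping.lookup m3 i) = 0"
    using monomial_split[of m2 0] m2 by auto
  have m: "(\<Prod>i\<in>UNIV. (z $ i) ^ Poly_Mapping.lookup m i) = z $ a * (z $ b * z $ c)" for z :: "'a ^ 'n"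
  proof -
    have "Poly_Mapping.lookup m3 i = 0" for i
      using m3(2) by simp
    then show ?thesis
      unfolding m1 m2 m3 monomial_single_mult by simp
  qed
  \<comment> \<open>The product of the coordinates \<open>a\<close>, \<open>b\<close>,
    \<open>c\<close>, averaged over the six orderings of the arguments.\<close>
  define T where "T x y z = (x $ a * y $ b * z $ c + x $ a * z $ b * y $ c + y $ a * x $ b * z $ c
    + y $ a * z $ b * x $ c + z $ a * x $ b * y $ c + z $ a * y $ b * x $ c) / 6"
    for x y z :: "'a ^ 'n"
  have "sym_trilinear T"
    by unfold_locales (auto simp: T_def field_simps)
  moreover have "T z z z = (\<Prod>i\<in>UNIV. (z $ i) ^ Poly_Mapping.lookup m i)" for z
    by (simp add: m T_def field_simps)
  ultimately show ?thesis
    by blast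
qed

lemma mhomogeneous_3_trilinear:
  fixes F :: "('n::finite, 'a::field_char_0) mpolynomial"
  assumes "mhomogeneous 3 F"
  obtains T where "sym_trilinear T" "\<And>z. meval F z = T z z z"
proof -
  have "\<forall>m\<in>Poly_Mapping.keys F. \<exists>T. sym_trilinear T \<and>
    (\<forall>z :: 'a ^ 'n. T z z z = (\<Prod>i\<in>UNIV. (z $ i) ^ Poly_Mapping.lookup m i))"
    using assms cubic_monomial by (auto simp: mhomogeneous_def)
  then obtain T where T: "\<And>m. m \<in> Poly_Mapping.keys F \<Longrightarrow> sym_trilinear (T m)"
    "\<And>m z. m \<in> Poly_Mapping.keys F \<Longrightarrow>
       T m z z z = (\<Prod>i\<in>UNIV. ((z :: 'a ^ 'n) $ i) ^ Poly_Mapping.lookup m i)"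
    by metis
  show ?thesis
  proof
    show "sym_trilinear (\<lambda>x y z. \<Sum>m\<in>Poly_Mapping.keys F. Poly_Mapping.lookup F m * T m x y z)"
      by (intro sym_trilinear_sum sym_trilinear_scale T)
    show "meval F z = (\<Sum>m\<in>Poly_Mapping.keys F. Poly_Mapping.lookup F m * T m z z z)" for z
      by (simp add: meval_def T)
  qed
qed

section \<open>Partial derivatives and smoothness in terms of the polarization\<close>

lemma DERIV_meval_mpderiv:
  fixes F :: "('n::finite, complex) mpolynomial"
  shows "((\<lambda>s. meval F (z + s *s axis i 1)) has_field_derivative meval (mpderiv i F) z) (at 0)"
proof -
  have mono: "((\<lambda>s. \<Prod>j\<in>UNIV. ((z + s *s axis i 1) $ j) ^ Poly_Mapping.lookup m j) has_field_derivative
      of_nat (Poly_Mapping.lookup m i) *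
      (\<Prod>j\<in>UNIV. (z $ j) ^ Poly_Mapping.lookup (m - Poly_Mapping.single i 1) j)) (at 0)"
    for m :: "'n \<Rightarrow>\<^sub>0 nat"
  proof -
    define r where "r = (\<Prod>j\<in>UNIV - {i}. (z $ j) ^ Poly_Mapping.lookup m j)"
    have "(\<Prod>j\<in>UNIV. ((z + s *s axis i 1) $ j) ^ Poly_Mapping.lookup m j)
        = (z $ i + s) ^ Poly_Mapping.lookup m i * r" for s
      unfolding r_def
      by (subst prod.remove[of _ i]) (auto simp: axis_def intro!: prod.cong)
    moreover have "(\<Prod>j\<in>UNIV. (z $ j) ^ Poly_Mapping.lookup (m - Poly_Mapping.single i 1) j)
        = (z $ i) ^ (Poly_Mapping.lookup m i - 1) * r"
      unfolding r_def
      by (subst prod.remove[of _ i])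
        (auto simp: lookup_minus lookup_single when_def intro!: prod.cong)
    moreover have "((\<lambda>s. (z $ i + s) ^ Poly_Mapping.lookup m i * r) has_field_derivative
        of_nat (Poly_Mapping.lookup m i) * ((z $ i) ^ (Poly_Mapping.lookup m i - 1) * r)) (at 0)"
      by (auto intro!: derivative_eq_intros)
    ultimately show ?thesis
      by (simp only:)
  qed
  have "meval (mpderiv i F) z = (\<Sum>m\<in>Poly_Mapping.keys F. Poly_Mapping.lookup F m *
      (of_nat (Poly_Mapping.lookup m i) *
      (\<Prod>j\<in>UNIV. (z $ j) ^ Poly_Mapping.lookup (m - Poly_Mapping.single i 1) j)))"
    by (simp add: mpderiv_def meval_sum meval_single mult_ac)
  then show ?thesis
    unfolding meval_def[of F] by (auto intro!: DERIV_sum DERIV_cmult mono simp only:)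
qed

text \<open>The right-hand side is the coefficient of \<open>t\<close> in \<open>cube_line\<close>
  for the direction \<open>axis i 1\<close>. Both sides are derivatives at 0 of the same function,
  so no exponents have to be compared.\<close>

lemma meval_mpderiv_trilinear:
  fixes F :: "('n::finite, complex) mpolynomial"
  assumes "sym_trilinear T" "\<And>z. meval F z = T z z z"
  shows "meval (mpderiv i F) z = 3 * T z z (axis i 1)"
proof -
  interpret sym_trilinear T by fact
  have "((\<lambda>s. meval F (z + s *s axis i 1)) has_field_derivative 3 * T z z (axis i 1)) (at 0)"
    unfolding assms(2) cube_line by (auto intro!: derivative_eq_intros)
  then show ?thesis
    by (rule DERIV_unique[OF DERIV_meval_mpderiv])
qed

text \<open>At points of the cubic this is the Jacobian criterion; off the cubic
  \<open>y = z\<close> already works. Hence the condition holds at every nonzero vector.\<close>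

lemma smooth_hypersurface_trilinear:
  fixes F :: "('n::finite, complex) mpolynomial"
  assumes "smooth_hypersurface F" "sym_trilinear T" "\<And>z. meval F z = T z z z" "z \<noteq> 0"
  shows "\<exists>y. T z z y \<noteq> 0"
proof (cases "T z z z = 0")
  case True
  then obtain i where "meval (mpderiv i F) z \<noteq> 0"
    using assms by (auto simp: smooth_hypersurface_def)
  then show ?thesis
    using meval_mpderiv_trilinear[OF assms(2,3)] by auto
qed blast

section \<open>Cubics vanishing on a smooth cubic\<close>

text \<open>Used on planes: with values of \<open>T\<close> as coefficients it yields a nonzero
  vector that smoothness then excludes.\<close>

lemma quadratic_form_zero:
  fixes \<alpha> \<beta> \<gamma> :: complex
  obtains a b where "a \<noteq> 0 \<or> b \<noteq> 0" "a ^ 2 * \<alpha> + 2 * a * b * \<beta> + b ^ 2 * \<gamma> = 0"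
proof (cases "\<alpha> = 0")
  case True
  then show ?thesis
    using that[of 1 0] by simp
next
  case False
  define s where "s = csqrt (\<beta> ^ 2 - \<alpha> * \<gamma>)"
  have s: "s * s = \<beta> * \<beta> - \<alpha> * \<gamma>"
    using power2_csqrt[of "\<beta> ^ 2 - \<alpha> * \<gamma>"] by (simp add: s_def power2_eq_square)
  define r where "r = (s - \<beta>) / \<alpha>"
  have "\<alpha> * r = s - \<beta>"
    using False by (simp add: r_def)
  then have "\<alpha> * (r ^ 2 * \<alpha> + 2 * r * \<beta> + \<gamma>) = 0"
    using s by Groebner_Basis.algebra
  then show ?thesis
    using that[of r 1] False by simp
qed

text \<open>Place both functionals as rows of a square matrix that also has a zero row; the matrix
  is singular, and a kernel vector is a common zero.\<close>

lemma common_kernel: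
  fixes f g :: "'a::field ^ 'n \<Rightarrow> 'a"
  assumes f: "\<And>x. f x = (\<Sum>i\<in>UNIV. x $ i * a i)"
    and g: "\<And>x. g x = (\<Sum>i\<in>UNIV. x $ i * b i)"
    and card: "CARD('n) \<ge> 3"
  obtains x where "x \<noteq> 0" "f x = 0" "g x = 0"
proof -
  obtain i j k :: 'n where ijk: "i \<noteq> j" "i \<noteq> k" "j \<noteq> k"
  proof -
    obtain S :: "'n set" where "card S = 3"
      using obtain_subset_with_card_n[OF card] by blast
    then show ?thesis
      using that by (auto simp: card_3_iff)
  qed
  define M :: "'a ^ 'n ^ 'n" where
    "M = (\<chi> r. if r = i then (\<chi> s. a s) else if r = j then (\<chi> s. b s) else 0)"
  have "row k M = 0"
    using ijk by (simp add: row_def M_def vec_eq_iff)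
  then have "det M = 0"
    by (rule det_zero_row)
  then have "\<not> invertible M"
    by (simp add: invertible_det_nz)
  then obtain x where x: "x \<noteq> 0" "M *v x = 0"
    by (metis invertible_left_inverse matrix_left_invertible_ker)
  have "f x = (M *v x) $ i" "g x = (M *v x) $ j"
    using ijk by (simp_all add: f g matrix_vector_mult_def M_def mult.commute)
  then show ?thesis
    using x that by simp
qed

text \<open>A weak substitute for being a polynomial function: only restrictions to lines are
  constrained. This suffices for cancelling factors that are not identically zero.\<close>

definition line_polynomial :: "('a::field ^ 'n \<Rightarrow> 'a) \<Rightarrow> bool" where
  "line_polynomial f \<longleftrightarrow> (\<forall>u v. \<exists>p. \<forall>t. f (u + t *s v) = poly p t)"

lemma line_polynomial_arith:
  assumes "line_polynomial f" "line_polynomial g"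
  shows line_polynomial_mult: "line_polynomial (\<lambda>v. f v * g v)"
    and line_polynomial_diff: "line_polynomial (\<lambda>v. f v - g v)"
proof -
  show "line_polynomial (\<lambda>v. f v * g v)"
    unfolding line_polynomial_def
  proof (intro allI)
    fix u v
    obtain p q where "\<And>t. f (u + t *s v) = poly p t" "\<And>t. g (u + t *s v) = poly q t"
      using assms by (metis line_polynomial_def)
    then show "\<exists>p. \<forall>t. f (u + t *s v) * g (u + t *s v) = poly p t"
      by (intro exI[of _ "p * q"]) simp
  qed
  show "line_polynomial (\<lambda>v. f v - g v)"
    unfolding line_polynomial_def
  proof (intro allI)
    fix u v
    obtain p q where "\<And>t. f (u + t *s v) = poly p t" "\<And>t. g (u + t *s v) = poly q t"
      using assms by (metis line_polynomial_def)
    then show "\<exists>p. \<forall>t. f (u + t *s v) - g (u + t *s v) = poly p t"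
      by (intro exI[of _ "p - q"]) simp
  qed
qed

lemma line_polynomial_const: "line_polynomial (\<lambda>v. c)"
  unfolding line_polynomial_def by (intro allI exI[of _ "[:c:]"]) simp

text \<open>Restrict to the line from \<open>u\<close> to \<open>v\<close>: univariate polynomials
  have no zero divisors, and the restriction of \<open>f\<close> is nonzero at \<open>t = 0\<close>,
  so that of \<open>g\<close> is the zero polynomial and vanishes at \<open>t = 1\<close>. The set
  \<open>S\<close> will be the whole space or a tangent hyperplane.\<close>

lemma line_polynomial_mult_eq_0:
  fixes f g :: "'a::field_char_0 ^ 'n \<Rightarrow> 'a"
  assumes "line_polynomial f" "line_polynomial g"
    and S: "\<And>u v t. u \<in> S \<Longrightarrow> v \<in> S \<Longrightarrow> u + t *s (v - u) \<in> S"
    and zero: "\<And>v. v \<in> S \<Longrightarrow> f v * g v = 0"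
    and "u \<in> S" "f u \<noteq> 0" "v \<in> S"
  shows "g v = 0"
proof (rule ccontr)
  assume "g v \<noteq> 0"
  obtain p q where p: "\<And>t. f (u + t *s (v - u)) = poly p t"
    and q: "\<And>t. g (u + t *s (v - u)) = poly q t"
    using assms(1,2) by (metis line_polynomial_def)
  have "poly (p * q) t = 0" for t
    using zero[OF S[OF \<open>u \<in> S\<close> \<open>v \<in> S\<close>]] by (simp flip: p q)
  then have "p * q = 0"
    using poly_all_0_iff_0 by blast
  moreover have "poly p 0 \<noteq> 0"
    using p[of 0] \<open>f u \<noteq> 0\<close> by simp
  moreover have "poly q 1 \<noteq> 0"
    using q[of 1] \<open>g v \<noteq> 0\<close> by simp
  ultimately show False
    by auto
qed

context sym_trilinear
begin

lemma line_polynomial_1: "line_polynomial (\<lambda>v. T a b v)"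
  unfolding line_polynomial_def
  by (intro allI, rule_tac x = "[:T a b u, T a b v:]" in exI) (simp add: linear_simps)

lemma line_polynomial_2: "line_polynomial (\<lambda>v. T a v v)"
  unfolding line_polynomial_def
  by (intro allI, rule_tac x = "[:T a u u, T a u v + T a v u, T a v v:]" in exI)
    (simp add: linear_simps algebra_simps)

lemma line_polynomial_3: "line_polynomial (\<lambda>v. T v v v)"
  unfolding line_polynomial_def
  by (intro allI, rule_tac x = "[:T u u u, 3 * T u u v, 3 * T u v v, T v v v:]" in exI)
    (simp add: cube_line power2_eq_square power3_eq_cube algebra_simps)

lemma diff3: "T x y (z - z') = T x y z - T x y z'"
  using add3[of x y "z - z'" z'] by simp

text \<open>The cubes of \<open>u + v\<close> and \<open>u - v\<close> determine both mixed terms.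
  The four vectors are listed separately so that the rule applies to a cubic vanishing only on a
  subspace.\<close>

lemma polarize:
  assumes "(6 :: 'a) \<noteq> 0"
    and "T v v v = 0" "T u u u = 0" "T (u + v) (u + v) (u + v) = 0"
    and "T (u + (-1) *s v) (u + (-1) *s v) (u + (-1) *s v) = 0"
  shows "T u u v = 0"
proof -
  have "3 * T u u v + 3 * T u v v = 0" "3 * T u v v - 3 * T u u v = 0"
    using cube_line[of u 1 v] cube_line[of u "-1" v] assms by simp_all
  then have "6 * T u u v = 0"
    by Groebner_Basis.algebra
  then show ?thesis
    using \<open>6 \<noteq> 0\<close> by simp
qed

text \<open>Polarize twice: first \<open>T u u v\<close> vanishes, then expanding
  \<open>T (x + y) (x + y) z\<close> leaves only \<open>2 * T x y z\<close>. Applied to differences,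
  this makes a cubic form determine its trilinear form.\<close>

lemma eq_0_if_cubes_eq_0:
  assumes "(6 :: 'a) \<noteq> 0" and "\<And>z. T z z z = 0"
  shows "T x y z = 0"
proof -
  have square: "T u u v = 0" for u v
    by (rule polarize) (use assms in auto)
  have "T (x + y) (x + y) z = T x x z + 2 * T x y z + T y y z"
    using swap12[of y x z] by (simp add: linear_simps)
  then have "2 * T x y z = 0"
    unfolding square by simp
  then have "6 * T x y z = 0"
    by Groebner_Basis.algebra
  then show ?thesis
    using assms(1) by simp
qed

end

text \<open>Both quadratics are multiples of \<open>(X - s) * (X - t)\<close>, hence
  \<open>a = c * s * t\<close> and \<open>a' = c' * s * t\<close>; this includes vanishing leading
  coefficients.\<close>

lemma proportional_quadratics:
  fixes a b c :: "'a::field"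
  assumes "s \<noteq> t" "c * s ^ 2 + b * s + a = 0" "c * t ^ 2 + b * t + a = 0"
    "c' * s ^ 2 + b' * s + a' = 0" "c' * t ^ 2 + b' * t + a' = 0"
  shows "c' * a = c * a'"
proof -
  have "(s - t) * (c * (s + t) + b) = 0"
    using assms(2,3) by Groebner_Basis.algebra
  moreover have "(s - t) * (c' * (s + t) + b') = 0"
    using assms(4,5) by Groebner_Basis.algebra
  ultimately have b: "b = - c * (s + t)" "b' = - c' * (s + t)"
    using \<open>s \<noteq> t\<close> by (simp_all add: add_eq_0_iff)
  have "a = c * s * t"
    using assms(2) b(1) by Groebner_Basis.algebra
  moreover have "a' = c' * s * t"
    using assms(4) b(2) by Groebner_Basis.algebra
  ultimately show ?thesis
    by simp
qed

lemma quadratic_two_roots: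
  fixes a b c :: complex
  assumes "c \<noteq> 0" "b ^ 2 - 4 * a * c \<noteq> 0"
  obtains s t where "s \<noteq> t" "c * s ^ 2 + b * s + a = 0" "c * t ^ 2 + b * t + a = 0"
proof -
  define d where "d = csqrt (b ^ 2 - 4 * a * c)"
  have d: "d * d = b * b - 4 * a * c" "d \<noteq> 0"
    using power2_csqrt[of "b ^ 2 - 4 * a * c"] assms by (auto simp: d_def power2_eq_square)
  show ?thesis
  proof
    show "(- b + d) / (2 * c) \<noteq> (- b - d) / (2 * c)"
      using assms d by (simp add: field_simps)
    show "c * ((- b + d) / (2 * c)) ^ 2 + b * ((- b + d) / (2 * c)) + a = 0"
      using \<open>c \<noteq> 0\<close> d(1) by (simp add: divide_simps power2_eq_square) Groebner_Basis.algebra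
    show "c * ((- b - d) / (2 * c)) ^ 2 + b * ((- b - d) / (2 * c)) + a = 0"
      using \<open>c \<noteq> 0\<close> d(1) by (simp add: divide_simps power2_eq_square) Groebner_Basis.algebra
  qed
qed

text \<open>Restrict to the line \<open>x + t *s y\<close> through two basis vectors. Either the
  restriction has degree 3 and a root, or \<open>T y y y = 0\<close> and \<open>y\<close> itself is
  the zero.\<close>

lemma (in sym_trilinear) exists_cubic_zero:
  assumes "\<And>p :: 'a poly. degree p = 3 \<Longrightarrow> \<exists>t. poly p t = 0" and "CARD('n) \<ge> 2"
  obtains z where "z \<noteq> 0" "T z z z = 0"
proof -
  obtain i j :: 'n where ij: "i \<noteq> j"
  proof -
    obtain S :: "'n set" where "card S = 2"
      using obtain_subset_with_card_n[OF assms(2)] by blast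
    then show ?thesis
      using that by (auto simp: card_2_iff)
  qed
  define x y :: "'a ^ 'n" where "x = axis i 1" and "y = axis j 1"
  show ?thesis
  proof (cases "T y y y = 0")
    case True
    have "y $ j \<noteq> 0"
      by (simp add: y_def)
    then show ?thesis
      using that True by (metis zero_index)
  next
    case False
    then obtain t where "poly [:T x x x, 3 * T x x y, 3 * T x y y, T y y y:] t = 0"
      using assms(1)[of "[:T x x x, 3 * T x x y, 3 * T x y y, T y y y:]"] by auto
    then have "T (x + t *s y) (x + t *s y) (x + t *s y) = 0"
      by (simp add: cube_line power2_eq_square power3_eq_cube algebra_simps)
    moreover have "(x + t *s y) $ i \<noteq> 0"
      using ij by (simp add: x_def y_def axis_def)
    ultimately show ?thesis
      using that by (metis zero_index)
  qed
qed

section \<open>Tangent hyperplanes and transversal lines of a smooth cubic\<close>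

locale smooth_cubic = sym_trilinear T for T :: "complex ^ 'n \<Rightarrow> complex ^ 'n \<Rightarrow> complex ^ 'n \<Rightarrow> complex" +
  assumes smooth: "z \<noteq> 0 \<Longrightarrow> \<exists>y. T z z y \<noteq> 0"
    and card_ge_3: "CARD('n) \<ge> 3"
begin

lemma exists_transversal_direction:
  assumes "p \<noteq> 0"
  obtains e where "T p p e = 1"
proof -
  obtain y where "T p p y \<noteq> 0"
    using smooth assms by blast
  then have "T p p (inverse (T p p y) *s y) = 1"
    by (simp add: linear_simps)
  then show ?thesis
    using that by blast
qed

text \<open>If the cubic vanished on the hyperplane \<open>T p p v = 0\<close>, polarization would
  make \<open>T v v\<close> vanish on it for each \<open>v\<close> in it. The hyperplane contains a
  plane, on which some nonzero \<open>v\<close> satisfies \<open>T v v e = 0\<close> as well; such a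
  \<open>v\<close> is singular.\<close>

lemma nonzero_on_tangent_space:
  assumes "T p p e = 1"
  obtains v where "T p p v = 0" "T v v v \<noteq> 0"
proof (rule ccontr)
  assume "\<not> thesis"
  then have cub: "T v v v = 0" if "T p p v = 0" for v
    using that \<open>\<And>v. T p p v = 0 \<Longrightarrow> T v v v \<noteq> 0 \<Longrightarrow> thesis\<close> by blast
  obtain x where x: "x \<noteq> 0" "T p p x = 0"
    using common_kernel[OF expand3 expand3 card_ge_3] by metis
  obtain i where i: "x $ i \<noteq> 0"
    using x(1) by (auto simp: vec_eq_iff)
  \<comment> \<open>The coordinate functional in the form that \<open>common_kernel\<close> expects;
    \<open>y $ i = 0\<close> makes \<open>y\<close> independent of \<open>x\<close>.\<close>
  have nth: "y $ i = (\<Sum>j\<in>UNIV. y $ j * (if j = i then 1 else 0))" for y :: "complex ^ 'n"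
    by (simp add: if_distrib cong: if_cong)
  obtain y where y: "y \<noteq> 0" "T p p y = 0" "y $ i = 0"
    using common_kernel[OF expand3 nth card_ge_3] by metis
  obtain a b where ab: "a \<noteq> 0 \<or> b \<noteq> 0" "a ^ 2 * T x x e + 2 * a * b * T x y e + b ^ 2 * T y y e = 0"
    using quadratic_form_zero .
  define v where "v = a *s x + b *s y"
  have "v \<noteq> 0"
  proof
    assume "v = 0"
    then have "v $ i = 0"
      by simp
    then have "a = 0"
      using i y(3) by (simp add: v_def)
    then show False
      using \<open>v = 0\<close> ab(1) y(1) by (simp add: v_def)
  qed
  have pv: "T p p v = 0"
    using x y by (simp add: v_def linear_simps)
  have "T v v e = 0"
    using ab(2) swap12[of y x e] by (simp add: v_def linear_simps power2_eq_square algebra_simps)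
  moreover have "T v v w = 0" if "T p p w = 0" for w
    by (rule polarize, simp; rule cub) (use that pv in \<open>simp_all only: add3 scale3\<close>, simp_all)
  \<comment> \<open>Splits \<open>w\<close> into a vector of the hyperplane and a multiple of
    \<open>e\<close>; \<open>T v v\<close> kills both.\<close>
  moreover have "T p p (w - T p p w *s e) = 0" for w
    using assms by (simp add: linear_simps diff3)
  ultimately have "T v v w = 0" for w
    by (metis diff3 scale3 mult_zero_right diff_zero)
  then show False
    using smooth[OF \<open>v \<noteq> 0\<close>] by simp
qed

text \<open>Up to a factor 3 the difference of the two sides is the discriminant of
  \<open>T v v v * t ^ 2 + 3 * T p v v * t + 3 * T p p v\<close>, which remains of the cubic on the
  line \<open>p + t *s v\<close> once the root \<open>t = 0\<close> is split off.\<close>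

lemma generic_line_transversal:
  assumes "T p p p = 0" "p \<noteq> 0"
  obtains v where "3 * T p v v ^ 2 \<noteq> 4 * T v v v * T p p v"
proof (rule ccontr)
  assume "\<not> thesis"
  then have disc: "3 * T p v v ^ 2 = 4 * T v v v * T p p v" for v
    using that by blast
  obtain e where e: "T p p e = 1"
    using exists_transversal_direction[OF assms(2)] .
  have quad: "T p v v = 0" if "T p p v = 0" for v
    using disc[of v] that by simp
  obtain v where "T p p v = 0" "T v v v \<noteq> 0"
    using nonzero_on_tangent_space[OF e] .
  \<comment> \<open>Moving off the tangent space by \<open>s\<close>, the discriminant identity reads
    \<open>4 (T v v v + O(s)) s = O(s\<^sup>2)\<close>.\<close>
  define k where "k = T p v e"
  define q where "q = T p e e"
  have "poly [:- 4 * T v v v, 12 * k ^ 2 - 12 * T v v e, 12 * k * q - 12 * T v e e, 3 * q ^ 2 - 4 * T e e e:] s = 0"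
    if "s \<noteq> 0" for s
  proof -
    have "T p (v + s *s e) (v + s *s e) = s * (2 * k + s * q)"
      using quad[OF \<open>T p p v = 0\<close>] swap23[of p e v]
      by (simp add: linear_simps k_def q_def algebra_simps)
    moreover have "T p p (v + s *s e) = s"
      using \<open>T p p v = 0\<close> e by (simp add: linear_simps)
    ultimately have "3 * (s * (2 * k + s * q)) ^ 2
        = 4 * (T v v v + 3 * s * T v v e + 3 * s ^ 2 * T v e e + s ^ 3 * T e e e) * s"
      using disc[of "v + s *s e"] by (simp only: cube_line)
    then have "s * (3 * s * (2 * k + s * q) ^ 2
        - 4 * (T v v v + 3 * s * T v v e + 3 * s ^ 2 * T v e e + s ^ 3 * T e e e)) = 0"
      by Groebner_Basis.algebra
    then have "3 * s * (2 * k + s * q) ^ 2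
        - 4 * (T v v v + 3 * s * T v v e + 3 * s ^ 2 * T v e e + s ^ 3 * T e e e) = 0"
      using that by simp
    then show ?thesis
      by (simp add: algebra_simps power2_eq_square power3_eq_cube)
  qed
  then have "- {0} \<subseteq> {s. poly [:- 4 * T v v v, 12 * k ^ 2 - 12 * T v v e,
      12 * k * q - 12 * T v e e, 3 * q ^ 2 - 4 * T e e e:] s = 0}"
    by blast
  moreover have "infinite (- {0 :: complex})"
    by (simp add: Compl_eq_Diff_UNIV infinite_UNIV_char_0)
  ultimately have "[:- 4 * T v v v, 12 * k ^ 2 - 12 * T v v e,
      12 * k * q - 12 * T v e e, 3 * q ^ 2 - 4 * T e e e:] = 0"
    using poly_roots_finite finite_subset by blast
  then show False
    using \<open>T v v v \<noteq> 0\<close> by simp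
qed

text \<open>On a generic line through \<open>p\<close> the two quadratics left after removing
  \<open>t = 0\<close> share two distinct roots, so their outer coefficients are proportional.
  Cancelling generic factors extends this relation to all \<open>v\<close>. On the tangent
  hyperplane it shows that \<open>T' p p\<close> is a multiple \<open>c\<close> of
  \<open>T p p\<close>, and cancelling \<open>T p p v\<close> gives the claim.\<close>

lemma vanishing_imp_proportional:
  assumes "sym_trilinear T'" and zero: "\<And>z. T z z z = 0 \<Longrightarrow> T' z z z = 0"
  obtains c where "\<And>z. T' z z z = c * T z z z"
proof -
  interpret T': sym_trilinear T' by fact
  have "CARD('n) \<ge> 2"
    using card_ge_3 by simp
  moreover have "\<exists>t. poly f t = 0" if "degree f = 3" for f :: "complex poly"
    by (rule fundamental_theorem_of_algebra) (use that in \<open>simp add: constant_degree\<close>)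
  ultimately obtain p where p: "p \<noteq> 0" "T p p p = 0"
    using exists_cubic_zero by blast
  obtain e where e: "T p p e = 1"
    using exists_transversal_direction[OF p(1)] .
  obtain w where w: "3 * T p w w ^ 2 - 4 * T w w w * T p p w \<noteq> 0"
    using generic_line_transversal[OF p(2,1)] by (metis eq_iff_diff_eq_0)
  obtain x where x: "T p p x = 0" "T x x x \<noteq> 0"
    using nonzero_on_tangent_space[OF e] .
  note lp = line_polynomial_1 line_polynomial_2 line_polynomial_3 line_polynomial_mult
    line_polynomial_diff line_polynomial_const T'.line_polynomial_1 T'.line_polynomial_3
  have generic: "T' v v v * T p p v - T v v v * T' p p v = 0"
    if v: "T p p v \<noteq> 0" "T v v v \<noteq> 0" "3 * T p v v ^ 2 - 4 * T v v v * T p p v \<noteq> 0" for v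
  proof -
    have "(3 * T p v v) ^ 2 - 4 * (3 * T p p v) * T v v v \<noteq> 0"
      using v(3) by (simp add: power2_eq_square algebra_simps)
    then obtain s t where st: "s \<noteq> t"
      "T v v v * s ^ 2 + 3 * T p v v * s + 3 * T p p v = 0"
      "T v v v * t ^ 2 + 3 * T p v v * t + 3 * T p p v = 0"
      using quadratic_two_roots[OF v(2), of "3 * T p v v" "3 * T p p v"] by blast
    have root: "T' v v v * r ^ 2 + 3 * T' p v v * r + 3 * T' p p v = 0"
      if r: "T v v v * r ^ 2 + 3 * T p v v * r + 3 * T p p v = 0" for r
    proof -
      have "r \<noteq> 0"
        using r v(1) by auto
      have "T (p + r *s v) (p + r *s v) (p + r *s v)
          = r * (T v v v * r ^ 2 + 3 * T p v v * r + 3 * T p p v)"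
        using p(2) by (simp add: cube_line power2_eq_square power3_eq_cube algebra_simps)
      then have "T' (p + r *s v) (p + r *s v) (p + r *s v) = 0"
        using zero r by simp
      then have "r * (T' v v v * r ^ 2 + 3 * T' p v v * r + 3 * T' p p v) = 0"
        using zero[OF p(2)] by (simp add: T'.cube_line power2_eq_square power3_eq_cube algebra_simps)
      then show ?thesis
        using \<open>r \<noteq> 0\<close> by simp
    qed
    have "T' v v v * (3 * T p p v) = T v v v * (3 * T' p p v)"
      by (rule proportional_quadratics[OF st root[OF st(2)] root[OF st(3)]])
    then show ?thesis
      by simp
  qed
  have all: "T' v v v * T p p v - T v v v * T' p p v = 0" for v
  proof -
    let ?D = "\<lambda>v. 3 * (T p v v * T p v v) - 4 * (T v v v * T p p v)"
    let ?g = "\<lambda>v. T' v v v * T p p v - T v v v * T' p p v"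
    have "T p p e \<noteq> 0"
      using e by simp
    \<comment> \<open>The three genericity conditions enter as factors and are cancelled one by one,
      with \<open>e\<close>, \<open>x\<close> and \<open>w\<close> as points where they do not
      vanish.\<close>
    have 0: "T p p v * (T v v v * (?D v * ?g v)) = 0" for v
      using generic[of v] by (auto simp only: power2_eq_square mult.assoc mult_eq_0_iff)
    have 1: "T v v v * (?D v * ?g v) = 0" for v
      by (rule line_polynomial_mult_eq_0[of "T p p" "\<lambda>v. T v v v * (?D v * ?g v)" UNIV e])
        (use 0 \<open>T p p e \<noteq> 0\<close> in \<open>auto intro!: lp simp only:\<close>)
    have 2: "?D v * ?g v = 0" for v
      by (rule line_polynomial_mult_eq_0[of "\<lambda>v. T v v v" "\<lambda>v. ?D v * ?g v" UNIV x])
        (use 1 x in \<open>auto intro!: lp simp only:\<close>)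
    show ?thesis
      by (rule line_polynomial_mult_eq_0[of ?D ?g UNIV w])
        (use 2 w in \<open>auto intro!: lp simp: power2_eq_square\<close>)
  qed
  \<comment> \<open>On the hyperplane the relation \<open>all\<close> reduces to
    \<open>T v v v * T' p p v = 0\<close>, and \<open>T v v v\<close> is nonzero at
    \<open>x\<close>.\<close>
  have tangent: "T' p p v = 0" if "T p p v = 0" for v
  proof (rule line_polynomial_mult_eq_0[of "\<lambda>v. T v v v" "T' p p" "{v. T p p v = 0}" x])
    show "T u u u * T' p p u = 0" if "u \<in> {v. T p p v = 0}" for u
      using all[of u] that by simp
  qed (use that x in \<open>auto intro: lp simp: linear_simps diff3\<close>)
  define c where "c = T' p p e"
  have "T' p p v = c * T p p v" for v
  proof -
    have "T' p p (v - T p p v *s e) = 0"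
      by (rule tangent) (simp add: diff3 linear_simps e)
    then show ?thesis
      by (simp add: T'.diff3 T'.linear_simps c_def)
  qed
  then have mult: "T p p v * (T' v v v - c * T v v v) = 0" for v
    using all[of v] by (simp add: algebra_simps)
  have "T' v v v - c * T v v v = 0" for v
    by (rule line_polynomial_mult_eq_0[of "T p p" "\<lambda>v. T' v v v - c * T v v v" UNIV e])
      (use mult e in \<open>auto intro!: lp\<close>)
  then show ?thesis
    using that[of c] by simp
qed

end

section \<open>Eigenvalues of a stabilizer\<close>

lemma jordan_matrix_nonzero_entry:
  assumes "i < sum_list (map fst n_as)" "j < sum_list (map fst n_as)"
    and "jordan_matrix n_as $$ (i, j) \<noteq> 0"
  shows "i = j \<or> Suc i = j \<and> jordan_matrix n_as $$ (i, i) = jordan_matrix n_as $$ (j, j)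
    \<and> jordan_matrix n_as $$ (i, j) = 1"
  using assms
proof (induction n_as arbitrary: i j)
  case (Cons na n_as)
  obtain n a where na: "na = (n, a)"
    by fastforce
  have entry: "jordan_matrix (na # n_as) $$ (k, l) =
      (if k < n then if l < n then jordan_block n a $$ (k, l) else 0
       else if l < n then 0 else jordan_matrix n_as $$ (k - n, l - n))"
    if "k < n + sum_list (map fst n_as)" "l < n + sum_list (map fst n_as)" for k l
    using that by (auto simp: na jordan_matrix_Cons)
  have less: "i < n + sum_list (map fst n_as)" "j < n + sum_list (map fst n_as)"
    using Cons.prems by (simp_all add: na)
  note entries = entry[OF less] entry[OF less(1) less(1)] entry[OF less(2) less(2)]
  consider "i < n" "j < n" | "\<not> i < n" "\<not> j < n"
    using Cons.prems(3) entries(1) by (auto split: if_splits)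
  then show ?case
  proof cases
    case 1
    then show ?thesis
      using Cons.prems(3) by (simp add: entries split: if_splits)
  next
    case 2
    then have "jordan_matrix n_as $$ (i - n, j - n) \<noteq> 0"
      using Cons.prems(3) by (simp add: entries)
    moreover have "i - n < sum_list (map fst n_as)" "j - n < sum_list (map fst n_as)"
      using 2 less by simp_all
    ultimately show ?thesis
      using Cons.IH[of "i - n" "j - n"] 2 by (auto simp: entries)
  qed
qed simp

text \<open>A permutation preserves the sum of the ranks \<open>h\<close>, so unless it is the
  identity it lowers some rank, and its Leibniz term contains a zero entry.\<close>

lemma det_triangular_rank:
  fixes M :: "'a::comm_ring_1 ^ 'n ^ 'n" and h :: "'n \<Rightarrow> nat"
  assumes "inj h" and upper: "\<And>i j. h j < h i \<Longrightarrow> M $ i $ j = 0"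
  shows "det M = (\<Prod>i\<in>UNIV. M $ i $ i)"
proof -
  have "(\<Prod>i\<in>UNIV. M $ i $ p i) = 0" if p: "p permutes UNIV" "p \<noteq> id" for p
  proof -
    have "\<exists>i. h (p i) < h i"
    proof (rule ccontr)
      assume "\<not> ?thesis"
      then have le: "h i \<le> h (p i)" for i
        by (simp add: not_less)
      have "(\<Sum>i\<in>UNIV. h (p i)) = (\<Sum>i\<in>UNIV. h i)"
        using sum.permute[OF p(1), of h] by (simp add: o_def)
      then have "h (p i) = h i" for i
        using sum_mono_inv[of h UNIV "\<lambda>i. h (p i)" i] le by simp
      then show False
        using \<open>inj h\<close> p(2) by (auto simp: inj_eq)
    qed
    then show ?thesis
      using upper by (intro prod_zero) auto
  qed
  then have "det M = (\<Sum>p\<in>{id}. of_int (sign p) * (\<Prod>i\<in>UNIV. M $ i $ p i))"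
    unfolding det_def
    by (intro sum.mono_neutral_right) (auto simp: finite_permutations permutes_id)
  then show ?thesis
    by simp
qed

text \<open>The Jordan normal form of the AFP is stated for matrices indexed by natural numbers; \<open>h\<close>
  below enumerates the index type.\<close>

lemma jordan_basis:
  fixes A :: "complex ^ 'n ^ 'n"
  obtains p :: "'n \<Rightarrow> complex ^ 'n" and \<mu> :: "'n \<Rightarrow> complex" and h :: "'n \<Rightarrow> nat"
  where "\<And>j. A *v p j = \<mu> j *s p j \<or> (\<exists>i. h i < h j \<and> \<mu> i = \<mu> j \<and> A *v p j = \<mu> j *s p j + p i)"
    and "\<And>z. \<exists>c. z = (\<Sum>j\<in>UNIV. c j *s p j)"
    and "\<And>c j. (\<Sum>j\<in>UNIV. c j *s p j) = 0 \<Longrightarrow> c j = 0"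
    and "det A = (\<Prod>j\<in>UNIV. \<mu> j)"
proof -
  define n where "n = CARD('n)"
  obtain h :: "'n \<Rightarrow> nat" where h: "bij_betw h UNIV {..<n}"
    using ex_bij_betw_finite_nat[of "UNIV :: 'n set"] by (auto simp: n_def atLeast0LessThan)
  have hn: "h i < n" for i
    using h by (auto simp: bij_betw_def)
  have "inj h"
    using h by (simp add: bij_betw_def)
  define conv :: "complex Matrix.mat \<Rightarrow> complex ^ 'n ^ 'n" where
    "conv M = (\<chi> i j. M $$ (h i, h j))" for M
  have conv_mult: "conv (M * N) = conv M ** conv N"
    if "M \<in> carrier_mat n n" "N \<in> carrier_mat n n" for M N
  proof -
    have "(M * N) $$ (h i, h j) = (\<Sum>k<n. M $$ (h i, k) * N $$ (k, h j))" for i j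
      using that hn by (simp add: scalar_prod_def atLeast0LessThan)
    also have "\<dots> i j = (\<Sum>k\<in>UNIV. M $$ (h i, h k) * N $$ (h k, h j))" for i j
      by (rule sum.reindex_bij_betw[OF h, symmetric])
    finally show ?thesis
      by (simp add: conv_def matrix_matrix_mult_def vec_eq_iff)
  qed
  have conv_one: "conv (1\<^sub>m n) = mat 1"
    using hn \<open>inj h\<close> by (simp add: conv_def mat_def vec_eq_iff inj_eq)
  define A' where "A' = Matrix.mat n n (\<lambda>(i, j). A $ (inv_into UNIV h i) $ (inv_into UNIV h j))"
  have A': "A' \<in> carrier_mat n n" and conv_A': "conv A' = A"
    using hn \<open>inj h\<close> by (simp_all add: A'_def conv_def vec_eq_iff)
  obtain n_as where "jordan_nf A' n_as"
    using char_poly_factorized[OF A'] jordan_nf_exists[OF A'] by blast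
  then obtain P Q where wit: "similar_mat_wit A' (jordan_matrix n_as) P Q"
    unfolding jordan_nf_def similar_mat_def by blast
  define J where "J = jordan_matrix n_as"
  from wit A' have PQ: "P \<in> carrier_mat n n" "Q \<in> carrier_mat n n" "J \<in> carrier_mat n n"
    "P * Q = 1\<^sub>m n" "Q * P = 1\<^sub>m n" "A' = P * J * Q"
    unfolding similar_mat_wit_def J_def Let_def by auto
  have dim: "sum_list (map fst n_as) = n"
    using carrier_matD(1)[OF PQ(3)] jordan_matrix_dim(1)[of n_as] unfolding J_def by (rule trans[OF sym, rotated])
  have cPQ: "conv P ** conv Q = mat 1" and cQP: "conv Q ** conv P = mat 1"
    using conv_mult[OF PQ(1,2)] conv_mult[OF PQ(2,1)] conv_one by (simp_all only: PQ(4,5))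
  have "conv (P * J * Q) = conv (P * J) ** conv Q"
    by (rule conv_mult) (use PQ in auto)
  then have A: "A = conv P ** conv J ** conv Q"
    unfolding conv_mult[OF PQ(1,3)] PQ(6)[symmetric] conv_A' .
  define p where "p j = column j (conv P)" for j
  define \<mu> where "\<mu> j = conv J $ j $ j" for j
  have J_entry: "i = j \<or> Suc (h i) = h j \<and> \<mu> i = \<mu> j \<and> conv J $ i $ j = 1"
    if "conv J $ i $ j \<noteq> 0" for i j
    using jordan_matrix_nonzero_entry[of "h i" n_as "h j"] hn that \<open>inj h\<close>
    by (auto simp: dim conv_def \<mu>_def J_def inj_eq)
  have sum_p: "(\<Sum>j\<in>UNIV. c j *s p j) = conv P *v (\<chi> j. c j)" for c
    by (simp add: matrix_mult_sum p_def)
  have "A ** conv P = conv P ** conv J ** (conv Q ** conv P)"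
    by (simp only: A matrix_mul_assoc)
  then have AP: "A ** conv P = conv P ** conv J"
    by (simp add: cQP)
  have Ap: "A *v p j = (\<Sum>i\<in>UNIV. conv J $ i $ j *s p i)" for j
  proof -
    have "A *v p j = column j (A ** conv P)"
      by (simp add: p_def column_def matrix_vector_mult_def matrix_matrix_mult_def)
    also have "\<dots> = conv P *v (\<chi> i. conv J $ i $ j)"
      unfolding AP by (simp add: column_def matrix_vector_mult_def matrix_matrix_mult_def)
    finally show ?thesis
      by (simp add: sum_p)
  qed
  show ?thesis
  proof
    fix j
    show "A *v p j = \<mu> j *s p j \<or> (\<exists>i. h i < h j \<and> \<mu> i = \<mu> j \<and> A *v p j = \<mu> j *s p j + p i)"
    proof (cases "\<exists>i. i \<noteq> j \<and> conv J $ i $ j \<noteq> 0")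
      case True
      then obtain i where i: "i \<noteq> j" "conv J $ i $ j \<noteq> 0"
        by blast
      have "A *v p j = (\<Sum>k\<in>{i, j}. conv J $ k $ j *s p k)"
        unfolding Ap
      proof (rule sum.mono_neutral_right)
        show "\<forall>k\<in>UNIV - {i, j}. conv J $ k $ j *s p k = 0"
        proof
          fix k assume k: "k \<in> UNIV - {i, j}"
          \<comment> \<open>A nonzero entry would give \<open>k\<close> and \<open>i\<close> the
            same rank, the predecessor of \<open>h j\<close>, and \<open>h\<close> is
            injective.\<close>
          have "conv J $ k $ j = 0"
            using J_entry[of k j] J_entry[OF i(2)] k i(1) \<open>inj h\<close> by (metis DiffE insertCI injD nat.inject)
          then show "conv J $ k $ j *s p k = 0"
            by simp
        qed
      qed auto
      also have "\<dots> = \<mu> j *s p j + p i"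
        using J_entry[OF i(2)] i(1) by (simp add: \<mu>_def)
      finally show ?thesis
        using J_entry[OF i(2)] i(1) by (metis lessI)
    next
      case False
      then have "A *v p j = (\<Sum>k\<in>{j}. conv J $ k $ j *s p k)"
        unfolding Ap by (intro sum.mono_neutral_right) auto
      then show ?thesis
        by (simp add: \<mu>_def)
    qed
  next
    fix z :: "complex ^ 'n"
    have "z = conv P *v (conv Q *v z)"
      by (simp add: matrix_vector_mul_assoc cPQ)
    then have "z = (\<Sum>j\<in>UNIV. (conv Q *v z) $ j *s p j)"
      by (simp add: sum_p)
    then show "\<exists>c. z = (\<Sum>j\<in>UNIV. c j *s p j)"
      by blast
  next
    fix c j
    assume "(\<Sum>j\<in>UNIV. c j *s p j) = 0"
    then have "conv Q *v (conv P *v (\<chi> j. c j)) = 0"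
      by (simp add: sum_p)
    then have "(\<chi> j. c j) = 0"
      by (simp add: matrix_vector_mul_assoc cQP)
    then have "(\<chi> j. c j) $ j = 0 $ j"
      by (rule arg_cong)
    then show "c j = 0"
      by simp
  next
    have "det (conv J) = (\<Prod>j\<in>UNIV. \<mu> j)"
      unfolding \<mu>_def
    proof (rule det_triangular_rank[OF \<open>inj h\<close>])
      show "conv J $ i $ j = 0" if "h j < h i" for i j
        using J_entry[of i j] that by auto
    qed
    moreover have "det (conv P) * det (conv Q) = 1"
      by (metis cPQ det_I det_mul)
    ultimately show "det A = (\<Prod>j\<in>UNIV. \<mu> j)"
      by (simp add: A det_mul mult_ac)
  qed
qed

text \<open>Expand \<open>T (A *v p i) (A *v p j) (A *v p k)\<close>. Every term other than the
  leading one is zero or moves some vectors down their chains, keeping the eigenvalues, and so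
  vanishes by induction on the sum of the ranks. What remains is
  \<open>(\<mu> i * \<mu> j * \<mu> k - 1) * T (p i) (p j) (p k) = 0\<close>.\<close>

lemma (in sym_trilinear) weight_condition:
  fixes p :: "'i \<Rightarrow> 'a ^ 'n" and h :: "'i \<Rightarrow> nat"
  assumes inv: "\<And>x y z. T (A *v x) (A *v y) (A *v z) = T x y z"
    and chain: "\<And>j. A *v p j = \<mu> j *s p j \<or>
      (\<exists>i. h i < h j \<and> \<mu> i = \<mu> j \<and> A *v p j = \<mu> j *s p j + p i)"
    and "\<mu> i * \<mu> j * \<mu> k \<noteq> 1"
  shows "T (p i) (p j) (p k) = 0"
  using assms(3)
proof (induction "h i + h j + h k" arbitrary: i j k rule: less_induct)
  case less
  have "\<forall>j. \<exists>x. A *v p j = \<mu> j *s p j + x \<and> (x = 0 \<or> (\<exists>i. h i < h j \<and> \<mu> i = \<mu> j \<and> x = p i))"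
    using chain by (metis add_0_right)
  then obtain x where x: "\<And>j. A *v p j = \<mu> j *s p j + x j"
    "\<And>j. x j = 0 \<or> (\<exists>i. h i < h j \<and> \<mu> i = \<mu> j \<and> x j = p i)"
    by metis
  have lower: "T (p i') (p j') (p k') = 0"
    if "h i' + h j' + h k' < h i + h j + h k" "\<mu> i' = \<mu> i" "\<mu> j' = \<mu> j" "\<mu> k' = \<mu> k" for i' j' k'
    using less that by metis
  have "T (x i) (p j) (p k) = 0" "T (p i) (x j) (p k) = 0" "T (p i) (p j) (x k) = 0"
    "T (x i) (x j) (p k) = 0" "T (x i) (p j) (x k) = 0" "T (p i) (x j) (x k) = 0"
    "T (x i) (x j) (x k) = 0"
    using x(2)[of i] x(2)[of j] x(2)[of k] by (auto intro!: lower)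
  then have "T (A *v p i) (A *v p j) (A *v p k) = \<mu> i * \<mu> j * \<mu> k * T (p i) (p j) (p k)"
    by (simp add: x(1) linear_simps)
  then have "(\<mu> i * \<mu> j * \<mu> k - 1) * T (p i) (p j) (p k) = 0"
    by (simp add: inv algebra_simps)
  then show ?case
    using less.prems by simp
qed

text \<open>On ninth roots of unity with \<open>w ^ 3 \<noteq> 1\<close>, the map \<open>f\<close>
  has orbits of length three and preserves \<open>w ^ 3\<close>. A repeated value propagates along
  its orbit, and a second orbit adds three more values; either way six indices would be needed. So
  at most one orbit of simple values occurs, and it contributes
  \<open>(w ^ 3) ^ 3 = 1\<close>.\<close>

lemma ninth_roots_product:
  fixes \<kappa> :: "'n::finite \<Rightarrow> 'a::field"
  assumes card: "CARD('n) = 5"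
    and ninth: "\<And>i. \<kappa> i ^ 9 = 1"
    and one: "\<And>i. \<exists>k. \<kappa> k * \<kappa> i ^ 2 = 1"
    and two: "\<And>i j. i \<noteq> j \<Longrightarrow> \<kappa> i = \<kappa> j \<Longrightarrow>
      \<exists>k l. k \<noteq> l \<and> \<kappa> k * \<kappa> i ^ 2 = 1 \<and> \<kappa> l * \<kappa> i ^ 2 = 1"
  shows "(\<Prod>i\<in>UNIV. \<kappa> i) ^ 3 = 1"
proof (cases "\<forall>i. \<kappa> i ^ 3 = 1")
  case True
  then show ?thesis
    by (simp add: prod_power_distrib)
next
  case False
  then obtain a where a: "\<kappa> a ^ 3 \<noteq> 1"
    by blast
  define f where "f w = inverse (w ^ 2)" for w :: 'a
  have next_iff: "\<kappa> k * \<kappa> i ^ 2 = 1 \<longleftrightarrow> \<kappa> k = f (\<kappa> i)" for i k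
  proof -
    have "\<kappa> i \<noteq> 0"
      using ninth[of i] by auto
    then show ?thesis
      by (simp add: f_def field_simps)
  qed
  have orbit: "f w \<noteq> w" "f (f w) \<noteq> w" "f (f w) \<noteq> f w" "f (f (f w)) = w"
    "f w ^ 3 = w ^ 3" "f (f w) ^ 3 = w ^ 3" if w: "w ^ 3 \<noteq> 1" "w ^ 9 = 1" for w
  proof -
    have "w \<noteq> 0"
      using w by auto
    have f1: "f w = w ^ 7"
    proof -
      have "w ^ 2 * w ^ 7 = 1"
        using w(2) by (simp flip: power_add)
      then show ?thesis
        by (simp add: f_def inverse_unique)
    qed
    have red: "w ^ (9 * q + r) = w ^ r" for q r
      by (simp add: power_add power_mult w(2))
    have f2: "f (f w) = w ^ 4"
    proof -
      have "f w ^ 2 * w ^ 4 = 1"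
        using red[of 2 0] by (simp add: f1 flip: power_mult power_add)
      then show ?thesis
        unfolding f_def[of "f w"] by (rule inverse_unique)
    qed
    have "f (f w) ^ 2 * w = 1"
      using w(2) by (simp add: f2 flip: power_mult power_Suc2)
    then show "f (f (f w)) = w"
      unfolding f_def[of "f (f w)"] by (rule inverse_unique)
    show "f w ^ 3 = w ^ 3"
      using red[of 2 3] by (simp add: f1 flip: power_mult)
    show "f (f w) ^ 3 = w ^ 3"
      using red[of 1 3] by (simp add: f2 flip: power_mult)
    have ne: "w ^ 6 \<noteq> 1"
    proof
      assume "w ^ 6 = 1"
      then have "w ^ 3 = 1"
        using w(2) power_add[of w 6 3] by simp
      then show False
        using w(1) by simp
    qed
    show "f w \<noteq> w"
    proof
      assume "f w = w"
      then have "w * w ^ 6 = w * 1"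
        by (simp add: f1 flip: power_Suc)
      then show False
        using ne \<open>w \<noteq> 0\<close> by simp
    qed
    show "f (f w) \<noteq> w"
    proof
      assume "f (f w) = w"
      then have "w * w ^ 3 = w * 1"
        by (simp add: f2 flip: power_Suc)
      then show False
        using w(1) \<open>w \<noteq> 0\<close> by simp
    qed
    show "f (f w) \<noteq> f w"
    proof
      assume "f (f w) = f w"
      then have "w ^ 4 = f w"
        by (simp add: f2)
      moreover have "w ^ 4 * w ^ 3 = f w"
        by (simp add: f1 flip: power_add)
      ultimately have "w ^ 4 * w ^ 3 = w ^ 4 * 1"
        by simp
      moreover have "w ^ 4 \<noteq> 0"
        using \<open>w \<noteq> 0\<close> by simp
      ultimately have "w ^ 3 = 1"
        using mult_left_cancel by blast
      then show False
        using w(1) by simp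
    qed
  qed
  have unique: "i = j" if ij: "\<kappa> i = \<kappa> j" "\<kappa> j ^ 3 \<noteq> 1" for i j
  proof (rule ccontr)
    assume "i \<noteq> j"
    then obtain k l where kl: "k \<noteq> l" "\<kappa> k = f (\<kappa> j)" "\<kappa> l = f (\<kappa> j)"
      using two ij(1) unfolding next_iff by metis
    then obtain m n where mn: "m \<noteq> n" "\<kappa> m = f (f (\<kappa> j))" "\<kappa> n = f (f (\<kappa> j))"
      using two unfolding next_iff by metis
    \<comment> \<open>Three distinct values of the orbit, each taken at two indices.\<close>
    have "card {i, j, k, l, m, n} = 6"
      using \<open>i \<noteq> j\<close> kl mn ij orbit[OF ij(2) ninth] by (auto simp: card_insert_if)
    then show False
      using card_mono[of UNIV "{i, j, k, l, m, n}"] card by simp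
  qed
  obtain b c where bc: "\<kappa> b = f (\<kappa> a)" "\<kappa> c = f (f (\<kappa> a))"
    using one unfolding next_iff by metis
  note orbit_a = orbit[OF a ninth]
  have rest: "\<kappa> j ^ 3 = 1" if j: "j \<notin> {a, b, c}" for j
  proof (rule ccontr)
    assume j3: "\<kappa> j ^ 3 \<noteq> 1"
    obtain k l where kl: "\<kappa> k = f (\<kappa> j)" "\<kappa> l = f (f (\<kappa> j))"
      using one unfolding next_iff by metis
    note orbit_j = orbit[OF j3 ninth]
    have "\<kappa> j \<noteq> \<kappa> a" "\<kappa> j \<noteq> \<kappa> b" "\<kappa> j \<noteq> \<kappa> c"
      using unique[of _ j] j j3 by (metis insertCI)+
    moreover from this have "f (\<kappa> j) \<noteq> \<kappa> a" "f (\<kappa> j) \<noteq> \<kappa> b" "f (\<kappa> j) \<noteq> \<kappa> c"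
      "f (f (\<kappa> j)) \<noteq> \<kappa> a" "f (f (\<kappa> j)) \<noteq> \<kappa> b" "f (f (\<kappa> j)) \<noteq> \<kappa> c"
      using orbit_a(4) orbit_j(4) bc by metis+
    ultimately have "card {a, b, c, j, k, l} = 6"
      using orbit_a orbit_j bc kl by (auto simp: card_insert_if)
    then show False
      using card_mono[of UNIV "{a, b, c, j, k, l}"] card by simp
  qed
  have "(\<Prod>i\<in>UNIV. \<kappa> i) ^ 3 = (\<Prod>i\<in>UNIV. \<kappa> i ^ 3)"
    by (simp add: prod_power_distrib)
  also have "\<dots> = (\<Prod>i\<in>{a, b, c}. \<kappa> i ^ 3)"
    by (rule prod.mono_neutral_right) (use rest in auto)
  also have "\<dots> = \<kappa> a ^ 3 * (\<kappa> a ^ 3 * \<kappa> a ^ 3)"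
  proof -
    have "a \<noteq> b" "a \<noteq> c" "b \<noteq> c"
      using orbit_a bc by metis+
    then show ?thesis
      using orbit_a bc by simp
  qed
  also have "\<dots> = 1"
    using ninth[of a] by (simp flip: power_add)
  finally show ?thesis .
qed

text \<open>The map \<open>w \<mapsto> w\<^sup>-\<^sup>2\<close> acts on a set of at most five values, so \<open>w\<close> has an order dividing some
  \<open>(-2)\<^sup>s - (-2)\<^sup>r\<close> with \<open>0 \<le> r < s \<le> 5\<close>; the least common multiple of these numbers
  is \<open>7920 = 2\<^sup>4 \<cdot> 9 \<cdot> 5 \<cdot> 11\<close>.\<close>

lemma eigenvalues_roots_of_unity:
  fixes \<mu> :: "'n::finite \<Rightarrow> 'a::field"
  assumes card: "CARD('n) = 5" and one: "\<And>i. \<exists>k. \<mu> k * \<mu> i ^ 2 = 1"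
  shows "\<mu> i ^ 7920 = 1"
proof -
  have nz: "\<mu> i \<noteq> 0" for i
    using one[of i] by auto
  obtain \<sigma> where \<sigma>: "\<And>i. \<mu> (\<sigma> i) * \<mu> i ^ 2 = 1"
    using one by metis
  define s where "s k = (\<sigma> ^^ k) i" for k
  have s: "\<mu> (s k) = \<mu> i powi ((-2) ^ k)" for k
  proof (induction k)
    case (Suc k)
    have "\<mu> (s (Suc k)) = inverse (\<mu> (s k) ^ 2)"
      using \<sigma>[of "s k"] nz[of "s k"] by (simp add: s_def field_simps)
    also have "\<dots> = \<mu> (s k) powi (- 2)"
      by (simp add: power_int_minus)
    also have "\<dots> = \<mu> i powi ((-2) ^ Suc k)"
      unfolding Suc by (simp flip: power_int_mult add: mult.commute)
    finally show ?case .
  qed (simp add: s_def)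
  \<comment> \<open>Pigeonhole: six iterates among five indices.\<close>
  have "\<not> inj_on s {..5}"
    using card_inj_on_le[of s "{..5}" UNIV] card by auto
  then obtain a b where ab: "a < b" "b \<le> 5" "s a = s b"
    unfolding inj_on_def by (metis atMost_iff linorder_neqE_nat)
  define e :: int where "e = (-2) ^ b - (-2) ^ a"
  have "\<mu> i powi e = 1"
    using s[of a] s[of b] ab(3) nz[of i] by (simp add: e_def power_int_diff)
  moreover have "e dvd 7920"
  proof -
    have "b \<in> {1, 2, 3, 4, 5}" "a \<in> {0, 1, 2, 3, 4}"
      using ab by auto
    then show ?thesis
      using ab(1) by (auto simp: e_def)
  qed
  then obtain k where "7920 = e * k"
    by blast
  ultimately have "\<mu> i powi 7920 = 1"
    by (simp only: power_int_mult power_int_1_left)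
  then show ?thesis
    by simp
qed

section \<open>Determinants of scalar matrices and of stabilizers\<close>

lemma det_mat: "det (mat c :: 'a::comm_ring_1 ^ 'n ^ 'n) = c ^ CARD('n)"
  by (subst det_diagonal) (simp_all add: mat_def)

lemma mult_mat_vec_scale: "(mat c ** A) *v z = c *s (A *v z)"
  for A :: "'a::field ^ 'n ^ 'n"
  by (simp add: matrix_vector_mul_assoc[symmetric] mat_mult_vec)

context smooth_cubic
begin

text \<open>If all cubes vanished, so would \<open>T\<close>, against smoothness. Such a vector
  allows scalar factors of the cubic to be compared.\<close>

lemma exists_nonzero: obtains z where "T z z z \<noteq> 0"
proof -
  have "axis undefined 1 \<noteq> (0 :: complex ^ 'n)"
    by (simp add: axis_eq_0_iff)
  then obtain y where "T (axis undefined 1) (axis undefined 1) y \<noteq> 0"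
    using smooth by blast
  then show ?thesis
    using eq_0_if_cubes_eq_0 that by (metis zero_neq_numeral)
qed

text \<open>The numbers \<open>\<kappa> i\<close> are the eigenvalues of the 880th power of
  \<open>A\<close> with multiplicity, and their product is \<open>det A ^ 880\<close>. Weights and
  smoothness supply the hypotheses of \<open>ninth_roots_product\<close>.\<close>

lemma det_power_stabilizer:
  fixes A :: "complex ^ 'n ^ 'n"
  assumes card: "CARD('n) = 5" and inv: "\<And>z. T (A *v z) (A *v z) (A *v z) = T z z z"
  shows "(det A ^ 880) ^ 3 = 1"
proof -
  have inv3: "T (A *v x) (A *v y) (A *v z) = T x y z" for x y z
  proof -
    \<comment> \<open>The defect of invariance is itself symmetric and trilinear, and its cubes
      vanish.\<close>
    interpret D: sym_trilinear "\<lambda>x y z. T (A *v x) (A *v y) (A *v z) + (-1) * T x y z"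
      by (intro sym_trilinear_add sym_trilinear_scale sym_trilinear_compose) unfold_locales
    show ?thesis
      using D.eq_0_if_cubes_eq_0[of x y z] inv by simp
  qed
  obtain p :: "'n \<Rightarrow> complex ^ 'n" and \<mu> and h :: "'n \<Rightarrow> nat" where
    chain: "\<And>j. A *v p j = \<mu> j *s p j \<or> (\<exists>i. h i < h j \<and> \<mu> i = \<mu> j \<and> A *v p j = \<mu> j *s p j + p i)"
    and span: "\<And>z. \<exists>c. z = (\<Sum>j\<in>UNIV. c j *s p j)"
    and indep: "\<And>c j. (\<Sum>j\<in>UNIV. c j *s p j) = 0 \<Longrightarrow> c j = 0"
    and det: "det A = (\<Prod>j\<in>UNIV. \<mu> j)"
    using jordan_basis[of A] by blast
  have weight: "\<mu> i * \<mu> j * \<mu> k = 1" if "T (p i) (p j) (p k) \<noteq> 0" for i j k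
    using weight_condition[OF inv3 chain] that by blast
  have partner: "\<exists>k. T z z (p k) \<noteq> 0" if "z \<noteq> 0" for z
  proof -
    obtain y where y: "T z z y \<noteq> 0"
      using smooth \<open>z \<noteq> 0\<close> by blast
    obtain c where "y = (\<Sum>j\<in>UNIV. c j *s p j)"
      using span by blast
    then have expand: "T z z y = (\<Sum>j\<in>UNIV. c j * T z z (p j))"
      by (simp add: sum3 scale3)
    show ?thesis
    proof (rule ccontr)
      assume "\<not> ?thesis"
      then show False
        using y expand by simp
    qed
  qed
  have combination: "a *s p i + b *s p j \<noteq> 0" if "i \<noteq> j" "a \<noteq> 0 \<or> b \<noteq> 0" for a b i j
  proof
    assume "a *s p i + b *s p j = 0"
    define c where "c k = (if k = i then a else if k = j then b else 0)" for k
    have "(\<Sum>k\<in>UNIV. c k *s p k) = (\<Sum>k\<in>{i, j}. c k *s p k)"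
      by (rule sum.mono_neutral_right) (auto simp: c_def)
    also have "\<dots> = 0"
      using \<open>i \<noteq> j\<close> \<open>a *s p i + b *s p j = 0\<close> by (simp add: c_def)
    finally have "c i = 0" "c j = 0"
      using indep by blast+
    then show False
      using that by (simp add: c_def split: if_splits)
  qed
  have one: "\<exists>k. \<mu> k * \<mu> i ^ 2 = 1" for i
  proof -
    have "p i \<noteq> 0"
    proof -
      have "UNIV \<noteq> {i}"
        using card by (metis is_singletonI is_singleton_altdef numeral_eq_one_iff num.distinct(3))
      then obtain j where "j \<noteq> i"
        by blast
      then show ?thesis
        using combination[of i j 1 0] by simp
    qed
    then obtain k where "T (p i) (p i) (p k) \<noteq> 0"
      using partner by blast
    then show ?thesis
      using weight[of i i k] by (auto simp: power2_eq_square mult_ac)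
  qed
  define \<kappa> where "\<kappa> i = \<mu> i ^ 880" for i
  have "\<kappa> i ^ 9 = 1" for i
    using eigenvalues_roots_of_unity[OF card one, of i] by (simp add: \<kappa>_def flip: power_mult)
  moreover have weight': "\<kappa> i * \<kappa> j * \<kappa> k = 1" if "T (p i) (p j) (p k) \<noteq> 0" for i j k
    using weight[OF that] by (simp add: \<kappa>_def flip: power_mult_distrib)
  have one': "\<exists>k. \<kappa> k * \<kappa> i ^ 2 = 1" for i
  proof -
    obtain k where "\<mu> k * \<mu> i ^ 2 = 1"
      using one by blast
    then have "(\<mu> k * \<mu> i ^ 2) ^ 880 = 1"
      by (simp only: power_one)
    then have "\<mu> k ^ 880 * (\<mu> i ^ 2) ^ 880 = 1"
      by (simp only: power_mult_distrib)
    then have "\<kappa> k * \<kappa> i ^ 2 = 1"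
      by (simp add: \<kappa>_def flip: power_mult)
    then show ?thesis ..
  qed
  moreover have "\<exists>k l. k \<noteq> l \<and> \<kappa> k * \<kappa> i ^ 2 = 1 \<and> \<kappa> l * \<kappa> i ^ 2 = 1"
    if ij: "i \<noteq> j" "\<kappa> i = \<kappa> j" for i j
  proof (rule ccontr)
    \<comment> \<open>If only \<open>p m\<close> had the complementary weight, a zero of a single quadratic form
      on the span of \<open>p i\<close> and \<open>p j\<close> would be a singular point.\<close>
    assume neg: "\<not> ?thesis"
    obtain m where m: "\<kappa> m * \<kappa> i ^ 2 = 1"
      using one' by blast
    obtain a b where ab: "a \<noteq> 0 \<or> b \<noteq> 0"
      "a ^ 2 * T (p i) (p i) (p m) + 2 * a * b * T (p i) (p j) (p m) + b ^ 2 * T (p j) (p j) (p m) = 0"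
      using quadratic_form_zero .
    define z where "z = a *s p i + b *s p j"
    have expand: "T z z (p k) = a ^ 2 * T (p i) (p i) (p k) + 2 * a * b * T (p i) (p j) (p k)
        + b ^ 2 * T (p j) (p j) (p k)" for k
      using swap12[of "p j" "p i" "p k"]
      by (simp add: z_def linear_simps power2_eq_square algebra_simps)
    obtain k where k: "T z z (p k) \<noteq> 0"
      using partner combination[OF ij(1) ab(1)] by (auto simp: z_def)
    have "k \<noteq> m"
      using k ab(2) expand by auto
    have "T (p i) (p i) (p k) \<noteq> 0 \<or> T (p i) (p j) (p k) \<noteq> 0 \<or> T (p j) (p j) (p k) \<noteq> 0"
      using k expand by auto
    then have "\<kappa> k * \<kappa> i ^ 2 = 1"
      using weight'[of i i k] weight'[of i j k] weight'[of j j k] ij(2)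
      by (auto simp: power2_eq_square mult_ac)
    then show False
      using neg m \<open>k \<noteq> m\<close> by blast
  qed
  ultimately have "(\<Prod>i\<in>UNIV. \<kappa> i) ^ 3 = 1"
    by (intro ninth_roots_product[OF card])
  then show ?thesis
    by (simp add: det \<kappa>_def prod_power_distrib)
qed

end

section \<open>Liftings\<close>

lemma group_hom_GL_to_PGL: "group_hom GL PGL (GL_to_PGL :: 'a::field ^ 'n ^ 'n \<Rightarrow> _)"
proof -
  have "GL_to_PGL \<in> hom (GL :: ('a ^ 'n ^ 'n) monoid) PGL"
    using normal.r_coset_hom_Mod[OF normal_scalar_mats]
    by (simp add: GL_to_PGL_def[abs_def] PGL_def)
  then show ?thesis
    by (simp add: group_hom_def group_hom_axioms_def group_GL group_PGL)
qed

lemma GL_to_PGL_eq_iff: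
  assumes "invertible A" "invertible B"
  shows "GL_to_PGL A = GL_to_PGL B \<longleftrightarrow> (\<exists>c. c \<noteq> 0 \<and> A = mat c ** (B :: 'a::field ^ 'n ^ 'n))"
proof -
  interpret group "GL :: ('a ^ 'n ^ 'n) monoid"
    by (rule group_GL)
  have S: "subgroup scalar_mats (GL :: ('a ^ 'n ^ 'n) monoid)"
    using normal_scalar_mats by (rule normal_imp_subgroup)
  have "A \<in> carrier GL" "B \<in> carrier GL"
    using assms by (simp_all add: GL_def)
  then have "GL_to_PGL A = GL_to_PGL B \<longleftrightarrow> A \<in> scalar_mats #>\<^bsub>GL\<^esub> B"
    unfolding GL_to_PGL_def using S repr_independence rcos_self by metis
  also have "\<dots> \<longleftrightarrow> (\<exists>c. c \<noteq> 0 \<and> A = mat c ** B)"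
    by (auto simp: r_coset_def GL_def scalar_mats_def)
  finally show ?thesis .
qed

text \<open>Passes from projective points to vectors of the affine cone: homogeneity makes the
  choice of representative harmless, and the zero vector is treated apart.\<close>

lemma lin_Aut_vanishing:
  fixes F :: "('n::finite, 'a::field_char_0) mpolynomial"
  assumes "mhomogeneous 3 F" "GL_to_PGL A \<in> lin_Aut (proj_hypersurface F)" "meval F z = 0"
  shows "meval F (A *v z) = 0"
proof -
  obtain T where T: "sym_trilinear T" "\<And>z. meval F z = T z z z"
    using mhomogeneous_3_trilinear[OF assms(1)] by blast
  interpret sym_trilinear T by fact
  show ?thesis
  proof (cases "z = 0")
    case True
    then show ?thesis
      by (simp add: T)
  next
    case False
    then have "proj_point z \<in> proj_hypersurface F"
      using assms(3) by (auto simp: proj_hypersurface_def)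
    then have "PGL_act (GL_to_PGL A) (proj_point z) \<in> proj_hypersurface F"
      using assms(2) by (auto simp: lin_Aut_def)
    then obtain y where y: "proj_point (A *v z) = proj_point y" "meval F y = 0"
      by (auto simp: PGL_act_proj_point proj_hypersurface_def)
    have "A *v z \<in> proj_point (A *v z)"
      by (auto simp: proj_point_def intro!: exI[of _ 1])
    then obtain c where "A *v z = c *s y"
      unfolding y(1) by (auto simp: proj_point_def)
    then show ?thesis
      using y(2) by (simp add: T linear_simps)
  qed
qed

section \<open>The lifting as the kernel of a power of the determinant\<close>

theorem theorem4p11:
  fixes F :: "(5, complex) mpolynomial"
    and X :: "(complex ^ 5) set set"
    and G :: "(complex ^ 5 ^ 5) set set"
  assumes "irreducible F"
    and "mhomogeneous 3 F"
    and "smooth_hypersurface F"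
    and "X = proj_hypersurface F"
    and "subgroup G PGL"
    and "G \<subseteq> lin_Aut X"
  shows "\<exists>H. is_F_lifting F G H"
proof -
  obtain T where T: "sym_trilinear T" "\<And>z. meval F z = T z z z"
    using mhomogeneous_3_trilinear[OF assms(2)] by blast
  interpret smooth_cubic T
    using T(1) smooth_hypersurface_trilinear[OF assms(3) T]
    by (auto simp: smooth_cubic_def smooth_cubic_axioms_def)
  interpret group_hom "GL :: (complex ^ 5 ^ 5) monoid" PGL GL_to_PGL
    by (rule group_hom_GL_to_PGL)
  \<comment> \<open>Invariance is expressed by values, which suits the trilinear form;
    \<open>meval_inject\<close> turns it into \<open>mat_subst A F = F\<close> at the end.\<close>
  define H where "H = {A. invertible A \<and> GL_to_PGL A \<in> G \<and>
    (\<forall>z. meval F (A *v z) = meval F z) \<and> det A ^ 880 = 1}"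
  obtain w where w: "T w w w \<noteq> 0"
    using exists_nonzero .
  have H_carrier: "A \<in> carrier GL" if "A \<in> H" for A
    using that by (simp add: H_def GL_def)
  have sub: "subgroup H GL"
  proof (rule G.subgroupI)
    show "H \<subseteq> carrier GL"
      using H_carrier by blast
    have "mat 1 \<in> H"
      using hom_one subgroup.one_closed[OF assms(5)] invertible_scalar_mat[of 1]
      by (simp add: H_def GL_def)
    then show "H \<noteq> {}"
      by blast
  next
    fix A assume A: "A \<in> H"
    define B where "B = inv\<^bsub>GL\<^esub> A"
    have B: "B \<in> carrier GL" "A ** B = mat 1"
      using G.inv_closed[OF H_carrier[OF A]] G.r_inv[OF H_carrier[OF A]] by (simp_all add: B_def GL_def)
    have "GL_to_PGL B \<in> G"
      using A subgroup.m_inv_closed[OF assms(5)] hom_inv[OF H_carrier[OF A]] by (simp add: B_def H_def)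
    moreover have "meval F (B *v z) = meval F z" for z
    proof -
      have "meval F (A *v (B *v z)) = meval F (B *v z)"
        using A by (simp add: H_def)
      then show ?thesis
        by (simp add: matrix_vector_mul_assoc B(2))
    qed
    moreover have "det B ^ 880 = 1"
    proof -
      have "(det A * det B) ^ 880 = 1"
        by (simp add: det_mul[symmetric] B(2))
      then show ?thesis
        using A by (simp add: H_def power_mult_distrib)
    qed
    ultimately show "inv\<^bsub>GL\<^esub> A \<in> H"
      using B(1) by (simp add: H_def B_def GL_def)
  next
    fix A B assume AB: "A \<in> H" "B \<in> H"
    then have "GL_to_PGL (A \<otimes>\<^bsub>GL\<^esub> B) \<in> G"
      using hom_mult[OF H_carrier H_carrier] subgroup.m_closed[OF assms(5)] by (simp add: H_def)
    then show "A \<otimes>\<^bsub>GL\<^esub> B \<in> H"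
      using AB by (simp add: H_def GL_def invertible_mult det_mul power_mult_distrib
          flip: matrix_vector_mul_assoc)
  qed
  have "inj_on GL_to_PGL H"
  proof (rule inj_onI)
    fix A B assume AB: "A \<in> H" "B \<in> H" "GL_to_PGL A = GL_to_PGL B"
    then obtain c where c: "c \<noteq> 0" "A = mat c ** B"
      using GL_to_PGL_eq_iff[of A B] by (auto simp: H_def)
    have "T w w w = c ^ 3 * T w w w"
    proof -
      have "T (A *v w) (A *v w) (A *v w) = T w w w" "T (B *v w) (B *v w) (B *v w) = T w w w"
        using AB by (simp_all add: H_def T)
      then show ?thesis
        by (simp add: c(2) mult_mat_vec_scale linear_simps power3_eq_cube mult.assoc)
    qed
    then have c3: "c ^ 3 = 1"
      using w by simp
    have "(c ^ 5 * det B) ^ 880 = 1"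
      using AB(1) by (simp add: H_def c(2) det_mul det_mat)
    then have "(c ^ 5) ^ 880 = 1"
      using AB(2) by (simp add: H_def power_mult_distrib)
    \<comment> \<open>The exponent is \<open>5 * 880 = 4400\<close>, which is 2 modulo 3; together
      with \<open>c ^ 3 = 1\<close> this forces \<open>c = 1\<close>.\<close>
    then have "c ^ (3 * 1466 + 2) = 1"
      by (simp flip: power_mult)
    then have "c ^ 2 = 1"
      unfolding power_add power_mult c3 by simp
    then have "c = 1"
      using c3 by (simp add: power3_eq_cube power2_eq_square)
    then show "A = B"
      by (simp add: c(2))
  qed
  moreover have "GL_to_PGL ` H = G"
  proof
    show "GL_to_PGL ` H \<subseteq> G"
      by (auto simp: H_def)
    show "G \<subseteq> GL_to_PGL ` H"
    proof
      fix g assume "g \<in> G"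
      then have "g \<in> carrier PGL"
        using subgroup.mem_carrier[OF assms(5)] by blast
      then obtain A where A: "invertible A" "g = GL_to_PGL A"
        by (auto simp: PGL_def FactGroup_def RCOSETS_def GL_to_PGL_def GL_def)
      have "T z z z = 0 \<Longrightarrow> T (A *v z) (A *v z) (A *v z) = 0" for z
        using lin_Aut_vanishing[OF assms(2), of A z] \<open>g \<in> G\<close> A(2) assms(4,6) by (auto simp: T)
      then obtain c where c: "\<And>z. T (A *v z) (A *v z) (A *v z) = c * T z z z"
        using vanishing_imp_proportional[OF sym_trilinear_compose[OF T(1)]] by metis
      have "c \<noteq> 0"
      proof
        assume "c = 0"
        obtain B where "A ** B = mat 1"
          using A(1) by (auto simp: invertible_def)
        then have "T w w w = T (A *v (B *v w)) (A *v (B *v w)) (A *v (B *v w))"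
          by (simp add: matrix_vector_mul_assoc)
        then show False
          using w c \<open>c = 0\<close> by simp
      qed
      \<comment> \<open>A cube root \<open>s\<close> of \<open>inverse c\<close>: scaling
        \<open>A\<close> by it multiplies the cubic by \<open>s ^ 3\<close>, which cancels
        \<open>c\<close>.\<close>
      have "\<exists>s. poly [:- inverse c, 0, 0, 1:] s = 0"
        by (rule fundamental_theorem_of_algebra) (simp add: constant_degree)
      then obtain s where s: "s ^ 3 * c = 1"
        using \<open>c \<noteq> 0\<close> by (auto simp: power3_eq_cube field_simps)
      then have "s \<noteq> 0"
        by auto
      have inv_s: "T ((mat s ** A) *v z) ((mat s ** A) *v z) ((mat s ** A) *v z) = T z z z" for z
      proof -
        have "T ((mat s ** A) *v z) ((mat s ** A) *v z) ((mat s ** A) *v z) = s ^ 3 * c * T z z z"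
          by (simp add: mult_mat_vec_scale linear_simps c power3_eq_cube)
        then show ?thesis
          by (simp add: s)
      qed
      define y where "y = det (mat s ** A) ^ 880"
      have y3: "y ^ 3 = 1"
        unfolding y_def by (rule det_power_stabilizer[OF _ inv_s]) simp
      then have "y \<noteq> 0"
        by auto
      \<comment> \<open>Multiplication by a cube root of unity \<open>r\<close> changes \<open>det\<^sup>8\<^sup>8\<^sup>0\<close> by \<open>r\<^sup>4\<^sup>4\<^sup>0\<^sup>0 = r\<^sup>2\<close>,
        so \<open>r = y\<close> is the correction.\<close>
      have prod: "mat y ** (mat s ** A) = mat (y * s) ** A"
        by (simp add: matrix_mul_assoc mat_mult_mat)
      have inv: "invertible (mat (y * s) ** A)"
        using invertible_mult[OF invertible_scalar_mat A(1)] \<open>y \<noteq> 0\<close> \<open>s \<noteq> 0\<close> by simp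
      have coset: "GL_to_PGL (mat (y * s) ** A) = g"
        unfolding A(2) GL_to_PGL_eq_iff[OF inv A(1)]
        using \<open>y \<noteq> 0\<close> \<open>s \<noteq> 0\<close> by (intro exI[of _ "y * s"]) simp
      have "mat (y * s) ** A \<in> H"
      proof -
        have "meval F ((mat y ** (mat s ** A)) *v z) = meval F z" for z
        proof -
          have "T ((mat y ** (mat s ** A)) *v z) ((mat y ** (mat s ** A)) *v z) ((mat y ** (mat s ** A)) *v z)
              = y ^ 3 * T ((mat s ** A) *v z) ((mat s ** A) *v z) ((mat s ** A) *v z)"
            by (simp only: mult_mat_vec_scale[of y] linear_simps power3_eq_cube mult.assoc)
          then show ?thesis
            unfolding T y3 inv_s by simp
        qed
        moreover have "det (mat y ** (mat s ** A)) ^ 880 = 1"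
        proof -
          have "det (mat y ** (mat s ** A)) = y ^ 5 * det (mat s ** A)"
            by (simp add: det_mul[of "mat y" "mat s ** A"] det_mat)
          then have "det (mat y ** (mat s ** A)) ^ 880 = (y ^ 5) ^ 880 * y"
            by (simp only: power_mult_distrib y_def[symmetric])
          \<comment> \<open>The exponents add up:
            \<open>5 * 880 + 1 = 4401 = 3 * 1467\<close>.\<close>
          also have "\<dots> = (y ^ 3) ^ 1467"
            by (simp flip: power_mult power_Suc2)
          finally show ?thesis
            by (simp add: y3)
        qed
        ultimately show ?thesis
          using \<open>g \<in> G\<close> inv coset by (simp add: H_def prod)
      qed
      then show "g \<in> GL_to_PGL ` H"
        using coset by blast
    qed
  qed
  ultimately have "bij_betw GL_to_PGL H G"
    by (simp add: bij_betw_def)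
  moreover have "GL_to_PGL \<in> hom (GL\<lparr>carrier := H\<rparr>) (PGL\<lparr>carrier := G\<rparr>)"
    by (rule homI) (use hom_mult H_carrier in \<open>auto simp: H_def\<close>)
  ultimately have "is_lifting G H"
    using sub by (simp add: is_lifting_def iso_def)
  moreover have "mat_subst A F = F" if "A \<in> H" for A
    by (rule meval_inject) (use that in \<open>simp add: meval_mat_subst H_def\<close>)
  ultimately show ?thesis
    by (auto simp: is_F_lifting_def)
qed

end
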